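(* Let $\mathbf{u}$ be a standard complementary-symmetric Rote sequence. Then the size of a minimal attractor of any pseudopalindromic prefix of $\mathbf{u}$ equals the number of distinct letters contained in the prefix. More precisely, let $(w_n)_{n=1}^{\infty}$ be the sequence of all non-empty pseudopalindromic prefixes of $\mathbf{u}$ ordered by length. Consider $w_n$ containing both letters, and let $a\in\{\mathtt 0,\mathtt 1\}$ be the letter such that $w_{n-1}a$ is a prefix of $w_n$. Then a minimal attractor of $w_n$ is of the following form: 1. If $w_n=E(w_n)$ and $w$ is the longest antipalindromic prefix of $w_n$ followed by $\overline{a}$, then $\Gamma=\{|w|,|w_{n-1}|\}$ is an attractor of $w_n$. 2. If $w_n=R(w_n)$, $w_{n-1}=E(w_{n-1})$, and $w$ is the longest palindromic prefix of $w_n$ followed by $\overline{a}$, then $\Gamma=\{|w|,|w_{n-1}|\}$ is an attractor of $w_n$. 3. If $w_n=R(w_n)$, $w_{n-1}=R(w_{n-1})$, and $m$ is the minimum index such that $w_i=R(w_i)$ for all $i\in\{m,\dots,n\}$, then the attractor of $w_m$ from Item 2 is an attractor of $w_n$; that is, $m\ge 2$, $w_{m-1}=E(w_{m-1})$, and, with $b\in\{\mathtt 0,\mathtt 1\}$ the letter such that $w_{m-1}b$ is a prefix of $w_m$ and $w$ the longest palindromic prefix of $w_m$ followed by $\overline{b}$, the set $\{|w|,|w_{m-1}|\}$ is an attractor of $w_n$.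
   Context: All words and sequences are over $\{\mathtt{0},\mathtt{1}\}$; $|w|$ is the length of $w$; positions in a word are indexed from $0$. Write $\overline{\mathtt 0}=\mathtt 1$, $\overline{\mathtt 1}=\mathtt 0$, and $\overline{v_0v_1\cdots v_{n-1}}=\overline{v_0}\,\overline{v_1}\cdots\overline{v_{n-1}}$. Reversal: $R(w_0w_1\cdots w_{n-1})=w_{n-1}\cdots w_1w_0$. Exchange antimorphism: $E(w_0w_1\cdots w_{n-1})=\overline{w_{n-1}}\cdots\overline{w_1}\,\overline{w_0}$. A word $w$ is a palindrome if $w=R(w)$, an antipalindrome if $w=E(w)$, and a pseudopalindrome if it is a palindrome or an antipalindrome. The empty word is both a palindrome and an antipalindrome. A prefix $w$ of a word $z$ is followed by a letter $c$ if $wc$ is a prefix of $z$. A Rote sequence is a binary infinite sequence having exactly $2n$ distinct factors of length $n$ for each $n\geq 1$. A Rote sequence is complementary-symmetric (CS) if for each of its factors $v$, the word $\overline{v}$ is also a factor of it. A CS Rote sequence $\mathbf{u}$ is standard if both $\mathtt{0}\mathbf{u}$ and $\mathtt{1}\mathbf{u}$ are CS Rote sequences. An attractor (string attractor) of a word $w=w_0\cdots w_{n-1}$ is a set $\Gamma\subset\{0,1,\dots,n-1\}$ such that every non-empty factor of $w$ has an occurrence $w_iw_{i+1}\cdots w_{j-1}$ in $w$ with $\{i,i+1,\dots,j-1\}\cap\Gamma\neq\emptyset$. A minimal attractor of $w$ is an attractor of $w$ of minimum size. *)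

theory Defs
  imports "HOL-Library.Omega_Words_Fun" "HOL-Library.Sublist"
begin

hide_const (open) Omega_Words_Fun.prefix Omega_Words_Fun.suffix

text \<open>
  The letters 0 and 1 are \<^term>\<open>False\<close> and \<^term>\<open>True\<close>. Finite words are lists, infinite
  sequences are functions on the natural numbers, and \<^term>\<open>u [i \<rightarrow> j]\<close> is the factor of the
  sequence \<open>u\<close> at the positions \<open>i, \<dots>, j - 1\<close>.
\<close>

definition complement :: "bool list \<Rightarrow> bool list"
  where "complement w = map Not w"

definition exchange :: "bool list \<Rightarrow> bool list"
  where "exchange w = complement (rev w)"

definition palindrome :: "bool list \<Rightarrow> bool"
  where "palindrome w \<longleftrightarrow> w = rev w"

definition antipalindrome :: "bool list \<Rightarrow> bool"
  where "antipalindrome w \<longleftrightarrow> w = exchange w"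

definition pseudopalindrome :: "bool list \<Rightarrow> bool"
  where "pseudopalindrome w \<longleftrightarrow> palindrome w \<or> antipalindrome w"

definition is_factor :: "bool list \<Rightarrow> (nat \<Rightarrow> bool) \<Rightarrow> bool"
  where "is_factor v u \<longleftrightarrow> (\<exists>i j. i \<le> j \<and> v = u [i \<rightarrow> j])"

definition rote :: "(nat \<Rightarrow> bool) \<Rightarrow> bool"
  where "rote u \<longleftrightarrow> (\<forall>n\<ge>1. card {v. is_factor v u \<and> length v = n} = 2 * n)"

definition cs_rote :: "(nat \<Rightarrow> bool) \<Rightarrow> bool"
  where "cs_rote u \<longleftrightarrow> rote u \<and> (\<forall>v. is_factor v u \<longrightarrow> is_factor (complement v) u)"

definition standard_cs_rote :: "(nat \<Rightarrow> bool) \<Rightarrow> bool"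
  where "standard_cs_rote u \<longleftrightarrow>
    cs_rote u \<and> cs_rote ([False] \<frown> u) \<and> cs_rote ([True] \<frown> u)"

definition attractor :: "nat set \<Rightarrow> bool list \<Rightarrow> bool"
  where "attractor \<Gamma> w \<longleftrightarrow> \<Gamma> \<subseteq> {0..<length w} \<and>
    (\<forall>v. v \<noteq> [] \<and> sublist v w \<longrightarrow>
      (\<exists>i j. i \<le> j \<and> j \<le> length w \<and> v = take (j - i) (drop i w) \<and> {i..<j} \<inter> \<Gamma> \<noteq> {}))"

definition minimal_attractor :: "nat set \<Rightarrow> bool list \<Rightarrow> bool"
  where "minimal_attractor \<Gamma> w \<longleftrightarrow>
    attractor \<Gamma> w \<and> (\<forall>\<Delta>. attractor \<Delta> w \<longrightarrow> card \<Gamma> \<le> card \<Delta>)"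

text \<open>
  Lengths of the non-empty pseudopalindromic prefixes of \<open>u\<close>, and the \<open>n\<close>-th such prefix
  ordered by length. Numbering starts at \<open>n = 1\<close>, whereas \<^const>\<open>enumerate\<close> counts from 0;
  the value at \<open>n = 0\<close> is irrelevant. The definition is meaningful for all \<open>n \<ge> 1\<close>
  provided that the set of lengths is infinite.
\<close>

definition pseudopal_lengths :: "(nat \<Rightarrow> bool) \<Rightarrow> nat set"
  where "pseudopal_lengths u = {l. l > 0 \<and> pseudopalindrome (u [0 \<rightarrow> l])}"

definition pseudopal_prefix :: "(nat \<Rightarrow> bool) \<Rightarrow> nat \<Rightarrow> bool list"
  where "pseudopal_prefix u n = u [0 \<rightarrow> enumerate (pseudopal_lengths u) (n - 1)]"

definition followed_by :: "bool list \<Rightarrow> bool \<Rightarrow> bool list \<Rightarrow> bool"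
  where "followed_by w c z \<longleftrightarrow> prefix (w @ [c]) z"

definition longest_followed_by ::
    "(bool list \<Rightarrow> bool) \<Rightarrow> bool \<Rightarrow> bool list \<Rightarrow> bool list \<Rightarrow> bool"
  where "longest_followed_by P c z w \<longleftrightarrow> P w \<and> followed_by w c z \<and>
    (\<forall>v. P v \<and> followed_by v c z \<longrightarrow> length v \<le> length w)"

end

theory Submission
  imports Defs "HOL-Number_Theory.Cong"
begin

text \<open>
  The difference sequence \<open>d\<close> of \<open>u\<close>, \<open>d i = (u i \<noteq> u (i + 1))\<close>, has complexity \<open>n + 1\<close> and its left
  special factors are exactly its prefixes; the pseudopalindromic prefixes of \<open>u\<close> of length \<open>l\<close> are
  those for which the prefix of \<open>d\<close> of length \<open>l - 1\<close> is a palindrome. A palindromic prefix \<open>c\<close> of \<open>d\<close>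
  followed by \<open>z\<close> is extended to the next one by its longest palindromic proper prefix followed by
  \<open>z\<close>. Hence, if \<open>k < l\<close> are consecutive lengths of pseudopalindromic prefixes of \<open>u\<close>, then \<open>p = k + 1\<close>
  and \<open>q = l - k\<close> are coprime, \<open>l = p + q - 1\<close>, and the prefix of length \<open>l\<close> is, up to
  complementation, invariant under shifts by \<open>p\<close> and \<open>q\<close>. The two prefixes are never both
  antipalindromes; if exactly one of them is, then the shift by \<open>q\<close> complements, and \<open>p - 1\<close> and
  \<open>p - q - 1\<close> form an attractor. Along a run of palindromic prefixes after an antipalindromic one of
  length \<open>k\<close>, the period \<open>k + 1\<close> persists, and so does the attractor.
\<close>

section \<open>Difference sequences of standard Rote sequences\<close>

definition diff_seq :: "(nat \<Rightarrow> bool) \<Rightarrow> nat \<Rightarrow> bool"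
  where "diff_seq u i \<longleftrightarrow> u i \<noteq> u (Suc i)"

definition word_at :: "(nat \<Rightarrow> bool) \<Rightarrow> nat \<Rightarrow> nat \<Rightarrow> bool list"
  where "word_at x n i = map (\<lambda>r. x (i + r)) [0..<n]"

lemma length_word_at [simp]: "length (word_at x n i) = n"
  by (simp add: word_at_def)

lemma word_at_eq_iff: "word_at x n i = word_at y n j \<longleftrightarrow> (\<forall>r<n. x (i + r) = y (j + r))"
  by (auto simp: word_at_def list_eq_iff_nth_eq)

lemma subsequence_eq_word_at: "x [i \<rightarrow> j] = word_at x (j - i) i"
  by (auto simp: word_at_def subsequence_def list_eq_iff_nth_eq)

lemma factors_eq_range: "{v. is_factor v x \<and> length v = n} = range (word_at x n)"
proof -
  have "is_factor (word_at x n i) x" for i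
    unfolding is_factor_def subsequence_eq_word_at
    by (rule exI[of _ i], rule exI[of _ "i + n"]) simp
  then show ?thesis
    by (auto simp: is_factor_def subsequence_eq_word_at)
qed

lemma finite_range_word_at [simp]: "finite (range (word_at x n))"
proof (rule finite_subset)
  show "finite {v::bool list. set v \<subseteq> UNIV \<and> length v = n}"
    by (rule finite_lists_length_eq) simp
qed auto

text \<open>Taking differences is two-to-one on the factors of length \<open>n + 1\<close> of
  \<open>u\<close>: a word and its complement have the same differences, and the first letter
  together with the differences recovers the word. Half of \<open>2 * (n + 1)\<close>
  remains.\<close>

lemma card_diff_seq_factors:
  assumes "cs_rote u"
  shows "card (range (word_at (diff_seq u) n)) = n + 1"
proof -
  let ?G = "range (word_at u (Suc n))"
  let ?h = "\<lambda>v. map (\<lambda>r. v ! r \<noteq> v ! Suc r) [0..<n]"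
  let ?H = "{v \<in> ?G. \<not> v ! 0}" and ?K = "{v \<in> ?G. v ! 0}"
  have card_G: "card ?G = 2 * (n + 1)"
    using assms unfolding cs_rote_def rote_def factors_eq_range by simp
  have compl: "complement v \<in> ?G" if "v \<in> ?G" for v
    using that assms factors_eq_range[of u "Suc n"] unfolding cs_rote_def complement_def
    by (metis (mono_tags, lifting) length_map mem_Collect_eq)
  have compl2: "complement (complement v) = v" for v
    by (simp add: complement_def comp_def)
  have compl0: "complement v ! 0 \<longleftrightarrow> \<not> v ! 0" if "v \<in> ?G" for v
    using that by (auto simp: complement_def)
  have "bij_betw complement ?H ?K"
  proof (rule bij_betw_byWitness[where f' = complement])
    show "complement ` ?H \<subseteq> ?K" "complement ` ?K \<subseteq> ?H"
      using compl compl0 by blast+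
  qed (use compl2 in blast)+
  then have "card ?H = card ?K"
    by (rule bij_betw_same_card)
  moreover have "card ?G = card ?H + card ?K"
  proof -
    have "card (?H \<union> ?K) = card ?H + card ?K"
    proof (rule card_Un_disjoint)
      show "finite ?H" "finite ?K"
        using finite_range_word_at[of u "Suc n"] by (auto intro: rev_finite_subset)
    qed blast
    moreover have "?H \<union> ?K = ?G"
      by blast
    ultimately show ?thesis
      by simp
  qed
  ultimately have card_G0: "card ?H = n + 1"
    using card_G by simp
  have h: "?h (word_at u (Suc n) i) = word_at (diff_seq u) n i" for i
    by (auto simp: word_at_def diff_seq_def simp del: upt_Suc)
  have h_compl: "?h (complement v) = ?h v" if "v \<in> ?G" for v
    using that by (auto simp: complement_def)
  have inj: "inj_on ?h ?H"
  proof (rule inj_onI)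
    fix v w
    assume vw: "v \<in> ?H" "w \<in> ?H" "?h v = ?h w"
    then have len: "length v = Suc n" "length w = Suc n"
      by auto
    have eq: "(v ! r \<noteq> v ! Suc r) = (w ! r \<noteq> w ! Suc r)" if "r < n" for r
      using arg_cong[OF vw(3), of "\<lambda>x. x ! r"] that by simp
    have "v ! r = w ! r" if "r \<le> n" for r
      using that
    proof (induction r)
      case 0
      then show ?case
        using vw by auto
    next
      case (Suc r)
      then show ?case
        using eq[of r] by auto
    qed
    then show "v = w"
      using len by (auto simp: list_eq_iff_nth_eq)
  qed
  have img: "?h ` ?H = range (word_at (diff_seq u) n)"
  proof
    have "?h v \<in> range (word_at (diff_seq u) n)" if "v \<in> ?G" for v
      using that h by auto
    then show "?h ` ?H \<subseteq> range (word_at (diff_seq u) n)"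
      by blast
    show "range (word_at (diff_seq u) n) \<subseteq> ?h ` ?H"
    proof
      fix x
      assume "x \<in> range (word_at (diff_seq u) n)"
      then obtain i where x: "x = ?h (word_at u (Suc n) i)"
        unfolding h by blast
      let ?v = "word_at u (Suc n) i"
      have v: "?v \<in> ?G"
        by blast
      show "x \<in> ?h ` ?H"
      proof (cases "?v ! 0")
        case True
        have "x = ?h (complement ?v)"
          using h_compl[OF v] x by simp
        moreover have "complement ?v \<in> ?H"
          using compl[OF v] compl0[OF v] True by simp
        ultimately show ?thesis
          by (rule image_eqI)
      next
        case False
        then show ?thesis
          using x v by (intro image_eqI[of _ _ ?v]) simp_all
      qed
    qed
  qed
  show ?thesis
    using card_image[OF inj, unfolded img] card_G0 by (rule trans)
qed

text \<open>If two different fibres had two elements each, dropping one from each would leave the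
  image unchanged, against the bound. Applied to \<open>tl\<close> and \<open>butlast\<close>, this
  makes the left and the right special factor of each length unique.\<close>

lemma fiber_unique:
  assumes "finite A" "card A \<le> card (f ` A) + 1"
    and "a \<in> A" "a' \<in> A" "a \<noteq> a'" "f a = f a'"
    and "b \<in> A" "b' \<in> A" "b \<noteq> b'" "f b = f b'"
  shows "f a = f b"
proof (rule ccontr)
  assume neq: "f a \<noteq> f b"
  have "f ` (A - {a, b}) = f ` A"
  proof
    show "f ` A \<subseteq> f ` (A - {a, b})"
    proof
      fix y
      assume "y \<in> f ` A"
      then obtain x where x: "x \<in> A" "y = f x"
        by blast
      have "a' \<in> A - {a, b}" "b' \<in> A - {a, b}"
        using assms neq by auto
      then show "y \<in> f ` (A - {a, b})"
        using x assms by (cases "x = a"; cases "x = b") (auto simp: image_iff)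
    qed
  qed blast
  then have "card (f ` A) \<le> card (A - {a, b})"
    using card_image_le[of "A - {a, b}" f] assms(1) by simp
  moreover have "card (A - {a, b}) = card A - 2" "card A \<ge> 2"
  proof -
    have "a \<noteq> b"
      using neq by blast
    then show "card (A - {a, b}) = card A - 2"
      using assms by (subst card_Diff_subset) auto
    have "card {a, b} \<le> card A"
      by (rule card_mono) (use assms in auto)
    then show "card A \<ge> 2"
      using \<open>a \<noteq> b\<close> by simp
  qed
  ultimately show False
    using assms(2) by linarith
qed

text \<open>The special factors of a standard Sturmian sequence, expressed by positions: prefixes
  are left special, left special factors are prefixes, and a length has at most one right special
  factor.\<close>

locale standard_sturmian =
  fixes d :: "nat \<Rightarrow> bool"
  assumes prefix_left_special: "\<exists>i. d i = b \<and> (\<forall>r<n. d (Suc i + r) = d r)"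
    and left_special_prefix:
      "\<lbrakk>d i \<noteq> d j; \<forall>r<n. d (Suc i + r) = d (Suc j + r); r < n\<rbrakk> \<Longrightarrow> d (Suc i + r) = d r"
    and right_special_unique:
      "\<lbrakk>\<forall>r<n. d (i + r) = d (j + r); d (i + n) \<noteq> d (j + n);
        \<forall>r<n. d (i' + r) = d (j' + r); d (i' + n) \<noteq> d (j' + n); r < n\<rbrakk>
       \<Longrightarrow> d (i + r) = d (i' + r)"

text \<open>Prepending either letter to \<open>u\<close> keeps the number of factors of the
  difference sequence, so it creates no new factor, and every prefix occurs after both letters. As
  each length has one factor more than the previous one, \<open>fiber_unique\<close> gives the other
  two properties.\<close>

lemma standard_sturmian_diff_seq:
  assumes "standard_cs_rote u"
  shows "standard_sturmian (diff_seq u)"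
proof
  let ?d = "diff_seq u"
  have card: "card (range (word_at ?d n)) = n + 1" for n
    using assms card_diff_seq_factors unfolding standard_cs_rote_def by blast
  have left: "\<exists>i. ?d i = b \<and> (\<forall>r<n. ?d (Suc i + r) = ?d r)" for b n
  proof -
    \<comment> \<open>The prepended letter is chosen so that the new first difference is
      \<open>b\<close>.\<close>
    define c where "c = (b \<noteq> u 0)"
    let ?e = "diff_seq ([c] \<frown> u)"
    have e: "?e 0 = b" "?e (Suc i) = ?d i" for i
      by (auto simp: diff_seq_def conc_def c_def)
    have "cs_rote ([c] \<frown> u)"
      using assms unfolding standard_cs_rote_def by (cases c) auto
    then have card_e: "card (range (word_at ?e (Suc n))) = Suc n + 1"
      by (rule card_diff_seq_factors)
    have "word_at ?d (Suc n) i = word_at ?e (Suc n) (Suc i)" for i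
      unfolding word_at_eq_iff by (simp only: add_Suc e) simp
    then have "range (word_at ?d (Suc n)) \<subseteq> range (word_at ?e (Suc n))"
      by auto
    then have "range (word_at ?d (Suc n)) = range (word_at ?e (Suc n))"
      using card[of "Suc n"] card_e by (intro card_subset_eq) auto
    then obtain i where "word_at ?d (Suc n) i = word_at ?e (Suc n) 0"
      by (metis rangeE rangeI)
    then have i: "\<forall>r<Suc n. ?d (i + r) = ?e r"
      by (simp add: word_at_eq_iff)
    then have "?d i = b"
      using e by force
    moreover have "\<forall>r<n. ?d (Suc i + r) = ?d r"
      using i e by (metis add_Suc_shift Suc_mono)
    ultimately show ?thesis
      by blast
  qed
  show "\<exists>i. ?d i = b \<and> (\<forall>r<n. ?d (Suc i + r) = ?d r)" for b n
    by (rule left)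
  have tl_word: "tl (word_at ?d (Suc n) i) = word_at ?d n (Suc i)" for n i
    by (auto simp: word_at_def list_eq_iff_nth_eq nth_tl simp del: upt_Suc)
  have butlast_word: "butlast (word_at ?d (Suc n) i) = word_at ?d n i" for n i
    by (simp add: word_at_def)
  have tl_surj: "tl ` range (word_at ?d (Suc n)) = range (word_at ?d n)" for n
  proof
    show "tl ` range (word_at ?d (Suc n)) \<subseteq> range (word_at ?d n)"
      using tl_word by auto
    have "\<exists>j. word_at ?d n i = word_at ?d n (Suc j)" for i
    proof (cases i)
      case 0
      then show ?thesis
        using left[of True n] by (auto simp: word_at_eq_iff)
    qed blast
    then show "range (word_at ?d n) \<subseteq> tl ` range (word_at ?d (Suc n))"
      using tl_word by (metis (no_types, lifting) image_eqI image_subsetI rangeI)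
  qed
  have butlast_surj: "butlast ` range (word_at ?d (Suc n)) = range (word_at ?d n)" for n
    by (simp add: image_image butlast_word)
  show "?d (Suc i + r) = ?d r"
    if ij: "?d i \<noteq> ?d j" "\<forall>r<n. ?d (Suc i + r) = ?d (Suc j + r)" and r: "r < n" for i j n r
  proof -
    obtain i' j' where i': "?d i'" "\<forall>r<n. ?d (Suc i' + r) = ?d r"
      and j': "\<not> ?d j'" "\<forall>r<n. ?d (Suc j' + r) = ?d r"
      using left[of True n] left[of False n] by blast
    let ?w = "word_at ?d (Suc n)"
    have "tl (?w i) = tl (?w i')"
    proof (rule fiber_unique[where f = tl and a = "?w i" and b = "?w i'" and A = "range ?w" and a' = "?w j" and b' = "?w j'"])
      show "finite (range ?w)" "card (range ?w) \<le> card (tl ` range ?w) + 1"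
        unfolding tl_surj using card by simp_all
      show "?w i \<in> range ?w" "?w j \<in> range ?w" "?w i' \<in> range ?w" "?w j' \<in> range ?w"
        by simp_all
      show "?w i \<noteq> ?w j"
        unfolding word_at_eq_iff using ij(1) by force
      show "?w i' \<noteq> ?w j'"
        unfolding word_at_eq_iff using i'(1) j'(1) by force
      show "tl (?w i) = tl (?w j)" "tl (?w i') = tl (?w j')"
        unfolding tl_word word_at_eq_iff using ij(2) i'(2) j'(2) by auto
    qed
    then show ?thesis
      unfolding tl_word word_at_eq_iff using i' r by auto
  qed
  show "?d (i + r) = ?d (i' + r)"
    if *: "\<forall>r<n. ?d (i + r) = ?d (j + r)" "?d (i + n) \<noteq> ?d (j + n)"
      "\<forall>r<n. ?d (i' + r) = ?d (j' + r)" "?d (i' + n) \<noteq> ?d (j' + n)" "r < n" for i j i' j' n r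
  proof -
    let ?w = "word_at ?d (Suc n)"
    have "butlast (?w i) = butlast (?w i')"
    proof (rule fiber_unique[where f = butlast and a = "?w i" and b = "?w i'" and A = "range ?w" and a' = "?w j" and b' = "?w j'"])
      show "finite (range ?w)" "card (range ?w) \<le> card (butlast ` range ?w) + 1"
        unfolding butlast_surj using card by simp_all
      show "?w i \<in> range ?w" "?w j \<in> range ?w" "?w i' \<in> range ?w" "?w j' \<in> range ?w"
        by simp_all
      show "?w i \<noteq> ?w j" "?w i' \<noteq> ?w j'"
        unfolding word_at_eq_iff using * by auto
      show "butlast (?w i) = butlast (?w j)" "butlast (?w i') = butlast (?w j')"
        unfolding butlast_word word_at_eq_iff using * by auto
    qed
    then show ?thesis
      unfolding butlast_word word_at_eq_iff using * by auto
  qed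
qed

section \<open>Palindromic prefixes of standard Sturmian sequences\<close>

definition pal_prefix :: "(nat \<Rightarrow> bool) \<Rightarrow> nat \<Rightarrow> bool"
  where "pal_prefix d m \<longleftrightarrow> (\<forall>i j. i + j + 1 = m \<longrightarrow> d i = d j)"

lemma pal_prefixD: "pal_prefix d m \<Longrightarrow> i + j + 1 = m \<Longrightarrow> d i = d j"
  by (simp add: pal_prefix_def)

lemma pal_prefix_0 [simp]: "pal_prefix d 0"
  by (simp add: pal_prefix_def)

text \<open>A palindrome occurring at 0 and at \<open>k\<close> is a border of the prefix of length
  \<open>m + k\<close>, and its symmetry matches the two ends. The bound on \<open>k\<close> leaves
  at most the central position uncovered.\<close>

lemma pal_prefix_extend:
  assumes pal: "pal_prefix d m" and per: "\<forall>r<m. d (k + r) = d r" and "k \<le> m + 1"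
  shows "pal_prefix d (m + k)"
  unfolding pal_prefix_def
proof (intro allI impI)
  have aux: "d i = d j" if "i + j + 1 = m + k" "i < m" for i j
  proof -
    have "d j = d (k + (m - 1 - i))"
      using that by (intro arg_cong[of _ _ d]) linarith
    also have "\<dots> = d (m - 1 - i)"
      using per[rule_format, of "m - 1 - i"] that by linarith
    also have "\<dots> = d i"
      using that by (intro pal_prefixD[OF pal]) linarith
    finally show ?thesis
      by simp
  qed
  fix i j
  assume ij: "i + j + 1 = m + k"
  show "d i = d j"
  proof (cases "i < m \<or> j < m")
    case True
    then show ?thesis
      using aux[of i j] aux[of j i] ij by (auto simp: add.commute)
  next
    case False
    then have "i = j"
      using ij \<open>k \<le> m + 1\<close> by linarith
    then show ?thesis
      by simp
  qed
qed

definition right_special_prefix :: "(nat \<Rightarrow> bool) \<Rightarrow> nat \<Rightarrow> bool"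
  where "right_special_prefix d m \<longleftrightarrow> (\<forall>b. \<exists>i. (\<forall>r<m. d (i + r) = d r) \<and> d (i + m) = b)"

lemma right_special_prefixI:
  assumes "\<forall>r<m. d (i + r) = d r" "d (i + m) \<noteq> d m"
  shows "right_special_prefix d m"
  unfolding right_special_prefix_def
proof
  fix b
  show "\<exists>i. (\<forall>r<m. d (i + r) = d r) \<and> d (i + m) = b"
  proof (cases "d m = b")
    case True
    then show ?thesis
      by (intro exI[of _ 0]) simp
  next
    case False
    then show ?thesis
      using assms by blast
  qed
qed

text \<open>
  A prefix of length \<open>l\<close> of \<open>u\<close> corresponds to the prefix of length \<open>l - 1\<close> of its difference
  sequence. Measured in \<open>u\<close>, \<open>\<sigma>\<close> is thus the length of a pseudopalindromic prefix, and the value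
  \<open>0\<close>, for which no palindromic prefix of \<open>d\<close> qualifies, is the empty prefix of \<open>u\<close>.
\<close>

definition border_length :: "(nat \<Rightarrow> bool) \<Rightarrow> nat \<Rightarrow> nat \<Rightarrow> bool"
  where "border_length d m \<sigma> \<longleftrightarrow> \<sigma> \<le> m \<and>
    (\<sigma> = 0 \<or> pal_prefix d (\<sigma> - 1) \<and> d (\<sigma> - 1) = d m) \<and>
    (\<forall>k<m. pal_prefix d k \<and> d k = d m \<longrightarrow> k < \<sigma>)"

lemma border_length_exists: "\<exists>\<sigma>. border_length d m \<sigma>"
proof (cases "\<exists>k<m. pal_prefix d k \<and> d k = d m")
  case True
  let ?P = "\<lambda>k. k < m \<and> pal_prefix d k \<and> d k = d m"
  have 1: "?P (Greatest ?P)"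
    by (rule GreatestI_ex_nat[of _ m]) (use True in auto)
  have 2: "k \<le> Greatest ?P" if "?P k" for k
    using that by (rule Greatest_le_nat[where b = m]) auto
  show ?thesis
    unfolding border_length_def
    by (rule exI[of _ "Suc (Greatest ?P)"]) (use 1 2 in \<open>auto simp: less_Suc_eq_le\<close>)
next
  case False
  then show ?thesis
    unfolding border_length_def by (intro exI[of _ 0]) auto
qed

text \<open>Reflecting in palindromic prefixes of lengths \<open>m\<close> and \<open>m + k\<close>
  yields one of length \<open>m - k\<close>, also followed by \<open>d m\<close>. For
  \<open>k\<close> in the given range it is longer than \<open>\<sigma>\<close> allows.\<close>

lemma no_pal_prefix_between:
  assumes pal: "pal_prefix d m" and \<sigma>: "border_length d m \<sigma>"
    and "0 < k" "k < m + 1 - \<sigma>"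
  shows "\<not> pal_prefix d (m + k)"
proof
  assume pal': "pal_prefix d (m + k)"
  have "k \<le> m"
    using assms by linarith
  have "pal_prefix d (m - k)"
    unfolding pal_prefix_def
  proof (intro allI impI)
    fix i j
    assume ij: "i + j + 1 = m - k"
    have "d i = d (j + k)"
      by (rule pal_prefixD[OF pal]) (use ij in linarith)
    also have "\<dots> = d (m - 1 - j)"
      by (rule pal_prefixD[OF pal']) (use ij in linarith)
    also have "\<dots> = d j"
      by (rule pal_prefixD[OF pal]) (use ij in linarith)
    finally show "d i = d j" .
  qed
  moreover have "d (m - k) = d m"
  proof -
    have "d (m - k) = d (k - 1)"
      by (rule pal_prefixD[OF pal]) (use \<open>k \<le> m\<close> \<open>0 < k\<close> in linarith)
    also have "\<dots> = d m"
      by (rule pal_prefixD[OF pal']) (use \<open>0 < k\<close> in linarith)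
    finally show ?thesis .
  qed
  ultimately have "m - k < \<sigma>"
    using \<sigma> \<open>0 < k\<close> \<open>k \<le> m\<close> unfolding border_length_def by auto
  then show False
    using assms by linarith
qed

lemma border_length_preceding:
  assumes "pal_prefix d m" "border_length d m \<sigma>"
  shows "d (m - \<sigma>) = d m"
proof (cases "\<sigma> = 0")
  case False
  then have "d (m - \<sigma>) = d (\<sigma> - 1)"
    using assms by (intro pal_prefixD[OF assms(1)]) (auto simp: border_length_def)
  then show ?thesis
    using assms False by (simp add: border_length_def)
qed simp

section \<open>Construction of the next palindromic prefix\<close>

context standard_sturmian
begin

text \<open>At the first failure \<open>s\<close> of the period, the prefix of length
  \<open>s\<close> is right special, hence a palindrome, and by maximality of
  \<open>\<sigma>\<close> it is not followed by \<open>d m\<close>. Yet with \<open>d m\<close>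
  appended it occurs after both letters, as only prefixes may.\<close>

lemma period_of_next_pal_prefix:
  assumes pal: "pal_prefix d m"
    and rs: "\<forall>k<m. right_special_prefix d k \<longrightarrow> pal_prefix d k"
    and \<sigma>: "border_length d m \<sigma>" and "r < m"
  shows "d (m + 1 - \<sigma> + r) = d r"
proof (rule ccontr)
  let ?q = "m + 1 - \<sigma>"
  let ?P = "\<lambda>r. r < m \<and> d (?q + r) \<noteq> d r"
  assume "d (?q + r) \<noteq> d r"
  then have "?P r"
    using \<open>r < m\<close> by blast
  define s where "s = Least ?P"
  have s: "s < m" "d (?q + s) \<noteq> d s"
    using LeastI[of ?P, OF \<open>?P r\<close>] by (simp_all add: s_def)
  have less_s: "d (?q + r) = d r" if "r < s" for r
    using not_less_Least[of r ?P] that s(1) by (auto simp: s_def)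
  have \<sigma>_le: "\<sigma> \<le> m"
    using \<sigma> by (simp add: border_length_def)
  have "d (?q + r) = d r" if "r < \<sigma>" for r
  proof (cases "r = \<sigma> - 1")
    case True
    then show ?thesis
      using \<sigma> that by (auto simp: border_length_def)
  next
    case False
    have "d (?q + r) = d (\<sigma> - 2 - r)"
      by (rule pal_prefixD[OF pal]) (use False that \<sigma>_le in linarith)
    also have "\<dots> = d r"
      by (rule pal_prefixD[of d "\<sigma> - 1"])
         (use \<sigma> that False in \<open>auto simp: border_length_def\<close>)
    finally show ?thesis .
  qed
  then have "\<sigma> \<le> s"
    using s(2) not_le by blast
  have "right_special_prefix d s"
    by (rule right_special_prefixI[of s d ?q]) (use less_s s in auto)
  then have pal_s: "pal_prefix d s"
    using rs s by blast
  then have ds: "d s \<noteq> d m"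
    using \<sigma> s(1) \<open>\<sigma> \<le> s\<close> unfolding border_length_def by force
  \<comment> \<open>By two reflections the prefix of length \<open>s\<close> also ends the prefix of
    length \<open>m\<close>, where \<open>d m\<close> follows it.\<close>
  have suf: "d (m - s + r) = d r" if "r < s" for r
  proof -
    have "d (m - s + r) = d (s - 1 - r)"
      by (rule pal_prefixD[OF pal]) (use that s(1) in linarith)
    also have "\<dots> = d r"
      by (rule pal_prefixD[OF pal_s]) (use that in linarith)
    finally show ?thesis .
  qed
  have "d (m - 1 - s) = d s"
    by (rule pal_prefixD[OF pal]) (use s(1) in linarith)
  moreover have "d (m - \<sigma>) = d m"
    by (rule border_length_preceding[OF pal \<sigma>])
  ultimately have 1: "d (m - \<sigma>) \<noteq> d (m - 1 - s)"
    using ds by simp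
  have suc: "Suc (m - \<sigma>) = ?q" "Suc (m - 1 - s) = m - s"
    using \<sigma>_le s(1) by simp_all
  \<comment> \<open>If \<open>v\<close> is the prefix of length \<open>s\<close> and \<open>z = d m\<close>, then \<open>v z\<close> is preceded by both letters,
    although it is not a prefix.\<close>
  have 2: "d (Suc (m - \<sigma>) + r) = d (Suc (m - 1 - s) + r)" if "r < Suc s" for r
  proof (cases "r = s")
    case True
    then show ?thesis
      unfolding suc using ds s by auto
  next
    case False
    then show ?thesis
      unfolding suc using less_s[of r] suf[of r] that by simp
  qed
  have "d (?q + s) = d s"
    using left_special_prefix[OF 1, of "Suc s" s] 2 unfolding suc by blast
  then show False
    using s by simp
qed

text \<open>Inductive step along the palindromic prefixes. No prefix of length strictly between
  \<open>m\<close> and \<open>m + q\<close> is right special, so the palindrome and its next letter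
  \<open>d m\<close> determine everything up to length \<open>m + q\<close>. Right speciality of the
  new palindrome is then carried from its suffix of length \<open>m + 1\<close> to longer
  suffixes.\<close>

lemma next_pal_prefix:
  assumes pal: "pal_prefix d m"
    and rs_m: "right_special_prefix d m"
    and rs: "\<forall>k<m. right_special_prefix d k \<longrightarrow> pal_prefix d k"
    and \<sigma>: "border_length d m \<sigma>"
  defines "q \<equiv> m + 1 - \<sigma>"
  shows "pal_prefix d (m + q)" "right_special_prefix d (m + q)"
    "\<forall>k<m + q. right_special_prefix d k \<longrightarrow> pal_prefix d k"
proof -
  have q: "0 < q" "q \<le> m + 1" "q - 1 = m - \<sigma>"
    using \<sigma> by (auto simp: border_length_def q_def)
  have per: "\<forall>r<m. d (q + r) = d r"
    using period_of_next_pal_prefix[OF pal rs \<sigma>] unfolding q_def by blast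
  show pal_q: "pal_prefix d (m + q)"
    by (rule pal_prefix_extend[OF pal per]) (use q in simp)
  have no_pal: "\<not> pal_prefix d (m + k)" if "0 < k" "k < q" for k
    using no_pal_prefix_between[OF pal \<sigma>] that unfolding q_def by blast
  have no_per: "\<exists>r<m. d (k + r) \<noteq> d r" if "0 < k" "k < q" for k
    using pal_prefix_extend[OF pal, of k] no_pal[OF that] that q by auto
  have dq: "d (q - 1) = d m"
    using border_length_preceding[OF pal \<sigma>] q by simp
  \<comment> \<open>The suffix of length \<open>m\<close> of such a prefix is right special, as is
    the palindrome of length \<open>m\<close>; by uniqueness they agree, which gives the excluded
    period \<open>k\<close>.\<close>
  have no_rs_shift: "\<not> right_special_prefix d (m + k)" if k: "0 < k" "k < q" for k
  proof
    assume "right_special_prefix d (m + k)"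
    then obtain i j
      where i: "\<forall>r<m + k. d (i + r) = d r" "d (i + (m + k))"
        and j: "\<forall>r<m + k. d (j + r) = d r" "\<not> d (j + (m + k))"
      unfolding right_special_prefix_def by metis
    obtain i' j'
      where i': "\<forall>r<m. d (i' + r) = d r" "d (i' + m)"
        and j': "\<forall>r<m. d (j' + r) = d r" "\<not> d (j' + m)"
      using rs_m unfolding right_special_prefix_def by metis
    have "d (k + r) = d r" if "r < m" for r
    proof -
      have "d ((i + k) + r) = d (i' + r)"
      proof (rule right_special_unique)
        show "\<forall>r<m. d (i + k + r) = d (j + k + r)"
          using i j by (auto simp: add.assoc)
        show "d (i + k + m) \<noteq> d (j + k + m)"
          using i j by (simp add: ac_simps)
        show "\<forall>r<m. d (i' + r) = d (j' + r)" "d (i' + m) \<noteq> d (j' + m)" "r < m"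
          using i' j' that by auto
      qed
      then show ?thesis
        using i i' that by (simp add: add.assoc)
    qed
    then show False
      using no_per[OF k] by blast
  qed
  have no_rs: "\<not> right_special_prefix d k" if "m < k" "k < m + q" for k
    using no_rs_shift[of "k - m"] that by auto
  show "\<forall>k<m + q. right_special_prefix d k \<longrightarrow> pal_prefix d k"
  proof (intro allI impI)
    fix k
    assume k: "k < m + q" "right_special_prefix d k"
    consider "k < m" | "k = m" | "m < k"
      by linarith
    then show "pal_prefix d k"
    proof cases
      case 3
      then show ?thesis
        using no_rs k by blast
    qed (use k rs pal in auto)
  qed
  have forced: "\<forall>r<m + q. d (i + r) = d r" if i: "\<forall>r\<le>m. d (i + r) = d r" for i
  proof (intro allI impI)
    fix r
    assume "r < m + q"
    then show "d (i + r) = d r"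
    proof (induction r rule: less_induct)
      case (less r)
      show ?case
      proof (cases "r \<le> m")
        case False
        show ?thesis
        proof (rule ccontr)
          assume "d (i + r) \<noteq> d r"
          then have "right_special_prefix d r"
            by (intro right_special_prefixI) (use less in auto)
          then show False
            using no_rs[of r] False less.prems by simp
        qed
      qed (use i in simp)
    qed
  qed
  \<comment> \<open>With \<open>c\<close> the prefix of length \<open>m\<close> and \<open>z = d m\<close>: were \<open>z c\<close> always followed by \<open>z\<close>, then \<open>d\<close>
    would be periodic with period \<open>q\<close>, and the prefix \<open>c z\<close> would not be left special.\<close>
  have "\<exists>i. d i = d m \<and> (\<forall>r<m. d (Suc i + r) = d r) \<and> d (Suc i + m) \<noteq> d m"
  proof (rule ccontr)
    assume neg: "\<not> ?thesis"
    have shift: "\<forall>r\<le>m. d (i + q + r) = d r" if i: "\<forall>r\<le>m. d (i + r) = d r" for i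
    proof -
      have f: "d (i + r) = d r" if "r < m + q" for r
        using forced[OF i] that by blast
      have suc: "Suc (i + (q - 1)) = i + q"
        using q by simp
      have "d (i + (q - 1)) = d m"
        using f[of "q - 1"] dq q(1) by auto
      moreover have "\<forall>r<m. d (i + q + r) = d r"
        using f per by (simp add: add.assoc)
      ultimately have "d (i + q + m) = d m"
        using neg suc by metis
      then show ?thesis
        using \<open>\<forall>r<m. d (i + q + r) = d r\<close> le_neq_implies_less by blast
    qed
    have mult: "\<forall>r\<le>m. d (k * q + r) = d r" for k
    proof (induction k)
      case (Suc k)
      then show ?case
        using shift[of "k * q"] by (simp add: add.commute)
    qed simp
    have periodic: "d (n + q) = d n" for n
    proof -
      have "d (k * q + r) = d r" if "r < q" for k r
        using forced[OF mult[of k]] that by simp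
      then have "d (Suc (n div q) * q + n mod q) = d (n div q * q + n mod q)"
        using q by (metis mod_less_divisor)
      moreover have "Suc (n div q) * q + n mod q = n + q"
        by (simp add: algebra_simps)
      ultimately show ?thesis
        by simp
    qed
    obtain i where i: "d i = (\<not> d m)" "\<forall>r<m + 1. d (Suc i + r) = d r"
      using prefix_left_special by blast
    have "\<forall>r<m + q. d (Suc i + r) = d r"
      by (rule forced) (use i in auto)
    then have "d (Suc i + (q - 1)) = d (q - 1)"
      using q by auto
    moreover have "Suc i + (q - 1) = i + q"
      using q by simp
    ultimately show False
      using periodic[of i] i dq by simp
  qed
  then obtain i0
    where i0: "d i0 = d m" "\<forall>r<m. d (Suc i0 + r) = d r" "d (Suc i0 + m) \<noteq> d m"
    by blast
  \<comment> \<open>A suffix of the new palindrome that is not a prefix is not left special, so both of its right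
    extensions have the same left extension.\<close>
  have lift: "\<exists>i. (\<forall>r<m + Suc k. d (i + r) = d (q - Suc k + r)) \<and> d (i + (m + Suc k)) = b"
    if "k < q" for k b
    using that
  proof (induction k)
    \<comment> \<open>The suffix of length \<open>m + 1\<close> is \<open>d m\<close> followed by
      the palindrome. Left speciality of the prefix of length \<open>m + 1\<close> yields its
      extension by \<open>d m\<close>, and \<open>i0\<close> the other one.\<close>
    case 0
    have eq: "d (q - 1 + r) = (if r = 0 then d m else d (r - 1))" if "r < Suc m" for r
    proof (cases r)
      case (Suc s)
      then have "q - 1 + r = q + s"
        using q by simp
      then show ?thesis
        using per that Suc by simp
    qed (use dq in simp)
    have *: "\<forall>r<m + Suc 0. d (i + r) = d (q - Suc 0 + r)"
      if "d i = d m" "\<forall>r<m. d (Suc i + r) = d r" for i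
    proof (intro allI impI)
      fix r
      assume "r < m + Suc 0"
      then show "d (i + r) = d (q - Suc 0 + r)"
        using eq[of r] that by (cases r) auto
    qed
    show ?case
    proof (cases "b = d m")
      case True
      obtain i where "d i = d m" "\<forall>r<m + 1. d (Suc i + r) = d r"
        using prefix_left_special by blast
      then show ?thesis
        using *[of i] True by (intro exI[of _ i]) auto
    next
      case False
      then show ?thesis
        using *[of i0] i0 by (intro exI[of _ i0]) auto
    qed
  next
    case (Suc k)
    then obtain i where i: "\<forall>r<m + Suc k. d (i + r) = d (q - Suc k + r)"
      "d (i + (m + Suc k)) = b"
      by auto
    \<comment> \<open>Were this suffix also a prefix, the copy of the palindrome at \<open>q\<close>
      would give one at \<open>Suc k\<close>, against \<open>no_per\<close>.\<close>
    have not_prefix: "\<not> (\<forall>r<m + Suc k. d (q - Suc k + r) = d r)"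
    proof
      assume pre: "\<forall>r<m + Suc k. d (q - Suc k + r) = d r"
      have "d (Suc k + r) = d r" if "r < m" for r
      proof -
        have "d (Suc k + r) = d (q - Suc k + (Suc k + r))"
          using pre[rule_format, of "Suc k + r"] that by simp
        also have "\<dots> = d (q + r)"
          using Suc.prems by (intro arg_cong[of _ _ d]) linarith
        also have "\<dots> = d r"
          using per that by blast
        finally show ?thesis .
      qed
      then show False
        using no_per[of "Suc k"] Suc.prems by auto
    qed
    then obtain i' where i': "i = Suc i'"
      using i(1) by (cases i) auto
    have q': "q - Suc k = Suc (q - Suc (Suc k))"
      using Suc.prems by simp
    have "d i' = d (q - Suc (Suc k))"
    proof (rule ccontr)
      assume "d i' \<noteq> d (q - Suc (Suc k))"
      then have "\<forall>r<m + Suc k. d (Suc i' + r) = d r"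
        using left_special_prefix[of i' "q - Suc (Suc k)" "m + Suc k"] i(1)
        unfolding i' q' by blast
      then show False
        using not_prefix i(1)[unfolded i'] by metis
    qed
    have "d (i' + r) = d (q - Suc (Suc k) + r)" if "r < m + Suc (Suc k)" for r
    proof (cases r)
      case 0
      then show ?thesis
        using \<open>d i' = d (q - Suc (Suc k))\<close> by simp
    next
      case (Suc r')
      then show ?thesis
        using i(1) that unfolding i' q' by auto
    qed
    then show ?case
      using i(2) unfolding i' by (intro exI[of _ i']) auto
  qed
  show "right_special_prefix d (m + q)"
    unfolding right_special_prefix_def using lift[of "q - 1"] q by simp
qed

text \<open>Induction along the palindromic prefixes, phrased by the greatest \<open>k\<close> up to
  \<open>m\<close> with all properties: the next palindromic prefix inherits them, and unless
  \<open>k = m\<close> its length is at most \<open>m\<close>, as none is skipped.\<close>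

lemma pal_prefix_right_special:
  assumes "pal_prefix d m"
  shows "right_special_prefix d m" "\<forall>k<m. right_special_prefix d k \<longrightarrow> pal_prefix d k"
proof -
  let ?good = "\<lambda>m. pal_prefix d m \<and> right_special_prefix d m \<and>
    (\<forall>k<m. right_special_prefix d k \<longrightarrow> pal_prefix d k)"
  let ?P = "\<lambda>k. k \<le> m \<and> ?good k"
  have "right_special_prefix d 0"
    unfolding right_special_prefix_def using prefix_left_special[of _ 0] by simp
  then have "?P 0"
    by simp
  define k where "k = Greatest ?P"
  have k: "?P k"
    unfolding k_def by (rule GreatestI_nat[where P = ?P and b = m, OF \<open>?P 0\<close>]) simp
  have max: "j \<le> k" if "?P j" for j
    unfolding k_def using that by (rule Greatest_le_nat[where b = m]) simp
  have "k = m"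
  proof (rule ccontr)
    assume "k \<noteq> m"
    obtain \<sigma> where \<sigma>: "border_length d k \<sigma>"
      using border_length_exists by blast
    let ?q = "k + 1 - \<sigma>"
    have good: "?good (k + ?q)"
      using next_pal_prefix[OF _ _ _ \<sigma>] k by blast
    have "0 < ?q"
      using \<sigma> by (simp add: border_length_def)
    have "m \<ge> k + ?q"
      using no_pal_prefix_between[of d k \<sigma> "m - k"] k \<sigma> assms \<open>k \<noteq> m\<close> by fastforce
    then have "k + ?q \<le> k"
      using good max by blast
    then show False
      using \<open>0 < ?q\<close> by linarith
  qed
  then show "right_special_prefix d m" "\<forall>k<m. right_special_prefix d k \<longrightarrow> pal_prefix d k"
    using k by auto
qed

end

section \<open>Pseudopalindromic prefixes and their periods\<close>

definition pal_lengths :: "(nat \<Rightarrow> bool) \<Rightarrow> nat set"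
  where "pal_lengths d = {l. 0 < l \<and> pal_prefix d (l - 1)}"

definition consecutive :: "nat set \<Rightarrow> nat \<Rightarrow> nat \<Rightarrow> bool"
  where "consecutive L k l \<longleftrightarrow> k \<in> L \<and> l \<in> L \<and> k < l \<and> (\<forall>m\<in>L. \<not> (k < m \<and> m < l))"

lemma consecutiveD: "consecutive L k l \<Longrightarrow> m \<in> L \<Longrightarrow> m < l \<Longrightarrow> m \<le> k"
  by (auto simp: consecutive_def)

lemma (in standard_sturmian) next_pal_length:
  assumes "l \<in> pal_lengths d"
  obtains \<sigma> where "\<sigma> < l" "\<sigma> = 0 \<or> \<sigma> \<in> pal_lengths d \<and> d (\<sigma> - 1) = d (l - 1)"
    "\<forall>m\<in>pal_lengths d. m < l \<and> d (m - 1) = d (l - 1) \<longrightarrow> m \<le> \<sigma>"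
    "\<forall>r<l - 1. d (r + (l - \<sigma>)) = d r"
    "consecutive (pal_lengths d) l (2 * l - \<sigma>)"
proof -
  define m where "m = l - 1"
  have l: "l = m + 1" and pal: "pal_prefix d m"
    using assms by (auto simp: pal_lengths_def m_def)
  obtain \<sigma> where \<sigma>: "border_length d m \<sigma>"
    using border_length_exists by blast
  have \<sigma>_le: "\<sigma> \<le> m"
    using \<sigma> by (simp add: border_length_def)
  note rs = pal_prefix_right_special[OF pal]
  have next_pal: "pal_prefix d (m + (m + 1 - \<sigma>))"
    by (rule next_pal_prefix(1)[OF pal rs \<sigma>])
  have "consecutive (pal_lengths d) l (2 * l - \<sigma>)"
    unfolding consecutive_def
  proof (intro conjI ballI)
    have "2 * l - \<sigma> - 1 = m + (m + 1 - \<sigma>)"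
      using l \<sigma>_le by simp
    then show "2 * l - \<sigma> \<in> pal_lengths d"
      using next_pal l \<sigma>_le by (simp add: pal_lengths_def)
    show "\<not> (l < t \<and> t < 2 * l - \<sigma>)" if "t \<in> pal_lengths d" for t
    proof
      assume t: "l < t \<and> t < 2 * l - \<sigma>"
      then have "m + (t - l) = t - 1"
        using l by simp
      then have "pal_prefix d (m + (t - l))"
        using that by (simp add: pal_lengths_def)
      moreover have "0 < t - l" "t - l < m + 1 - \<sigma>"
        using t l by linarith+
      ultimately show False
        using no_pal_prefix_between[OF pal \<sigma>] by blast
    qed
  qed (use assms l \<sigma>_le in auto)
  moreover have "\<forall>r<l - 1. d (r + (l - \<sigma>)) = d r"
    using period_of_next_pal_prefix[OF pal rs(2) \<sigma>] l by (simp add: add.commute)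
  moreover have "\<sigma> < l" "\<sigma> = 0 \<or> \<sigma> \<in> pal_lengths d \<and> d (\<sigma> - 1) = d (l - 1)"
    using \<sigma> l by (auto simp: border_length_def pal_lengths_def)
  moreover have "\<forall>m\<in>pal_lengths d. m < l \<and> d (m - 1) = d (l - 1) \<longrightarrow> m \<le> \<sigma>"
  proof (intro ballI impI)
    fix t
    assume "t \<in> pal_lengths d" "t < l \<and> d (t - 1) = d (l - 1)"
    then have "t - 1 < \<sigma>"
      using \<sigma> l by (auto simp: border_length_def pal_lengths_def)
    then show "t \<le> \<sigma>"
      by simp
  qed
  ultimately show thesis
    using that by blast
qed

text \<open>
  The prefix of length \<open>l\<close> has the coprime periods \<open>k + 1\<close> and \<open>l - k\<close> up to complementation.
  Whether a shift by such a period complements is read off from the types of the prefixes of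
  lengths \<open>k\<close> and \<open>l\<close>.
\<close>

definition stage :: "(nat \<Rightarrow> bool) \<Rightarrow> nat \<Rightarrow> nat \<Rightarrow> bool"
  where "stage u k l \<longleftrightarrow> (let d = diff_seq u; L = pal_lengths d in
    consecutive L k l \<and> l \<le> 2 * k \<and> coprime (k + 1) (l - k) \<and>
    (\<forall>i. i + (k + 1) < l \<longrightarrow> (u (i + (k + 1)) \<noteq> u i) = (u (k - 1) = u 0)) \<and>
    (\<forall>i<k. (u (i + (l - k)) \<noteq> u i) = (u (k - 1) \<noteq> u (l - 1))) \<and>
    \<not> (u (k - 1) \<noteq> u 0 \<and> u (l - 1) \<noteq> u 0) \<and>
    (\<forall>m\<in>L. m < k \<and> d (m - 1) = d (k - 1) \<longrightarrow> m \<le> 2 * k - l) \<and>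
    (l - k = 1 \<or> l - k - 1 \<in> L \<and> d (l - k - 2) \<noteq> d (k - 1)) \<and>
    (\<forall>m\<in>L. m < k \<and> d (m - 1) \<noteq> d (k - 1) \<longrightarrow> m \<le> l - k - 1))"

lemma stageD:
  assumes "stage u k l"
  shows "consecutive (pal_lengths (diff_seq u)) k l" "l \<le> 2 * k" "coprime (k + 1) (l - k)"
    and "\<And>i. i + (k + 1) < l \<Longrightarrow> (u (i + (k + 1)) \<noteq> u i) = (u (k - 1) = u 0)"
    and "\<And>i. i < k \<Longrightarrow> (u (i + (l - k)) \<noteq> u i) = (u (k - 1) \<noteq> u (l - 1))"
    and "\<not> (u (k - 1) \<noteq> u 0 \<and> u (l - 1) \<noteq> u 0)"
    and "\<And>m. \<lbrakk>m \<in> pal_lengths (diff_seq u); m < k; diff_seq u (m - 1) = diff_seq u (k - 1)\<rbrakk>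
      \<Longrightarrow> m \<le> 2 * k - l"
    and "l - k = 1 \<or> l - k - 1 \<in> pal_lengths (diff_seq u) \<and>
      diff_seq u (l - k - 2) \<noteq> diff_seq u (k - 1)"
    and "\<And>m. \<lbrakk>m \<in> pal_lengths (diff_seq u); m < k; diff_seq u (m - 1) \<noteq> diff_seq u (k - 1)\<rbrakk>
      \<Longrightarrow> m \<le> l - k - 1"
  using assms unfolding stage_def Let_def by blast+

lemma stageI:
  assumes "consecutive (pal_lengths (diff_seq u)) k l" "l \<le> 2 * k" "coprime (k + 1) (l - k)"
    and "\<And>i. i + (k + 1) < l \<Longrightarrow> (u (i + (k + 1)) \<noteq> u i) = (u (k - 1) = u 0)"
    and "\<And>i. i < k \<Longrightarrow> (u (i + (l - k)) \<noteq> u i) = (u (k - 1) \<noteq> u (l - 1))"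
    and "\<not> (u (k - 1) \<noteq> u 0 \<and> u (l - 1) \<noteq> u 0)"
    and "\<And>m. \<lbrakk>m \<in> pal_lengths (diff_seq u); m < k; diff_seq u (m - 1) = diff_seq u (k - 1)\<rbrakk>
      \<Longrightarrow> m \<le> 2 * k - l"
    and "l - k = 1 \<or> l - k - 1 \<in> pal_lengths (diff_seq u) \<and>
      diff_seq u (l - k - 2) \<noteq> diff_seq u (k - 1)"
    and "\<And>m. \<lbrakk>m \<in> pal_lengths (diff_seq u); m < k; diff_seq u (m - 1) \<noteq> diff_seq u (k - 1)\<rbrakk>
      \<Longrightarrow> m \<le> l - k - 1"
  shows "stage u k l"
  using assms unfolding stage_def Let_def by blast

lemma stage_base: "stage u 1 2"
proof -
  have "m = 1" if "m \<in> pal_lengths d" "m < 2" for m d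
    using that by (auto simp: pal_lengths_def)
  moreover have "1 \<in> pal_lengths d" "2 \<in> pal_lengths d" for d
    by (auto simp: pal_lengths_def pal_prefix_def)
  ultimately show ?thesis
    by (auto simp: stage_def Let_def consecutive_def pal_lengths_def)
qed

text \<open>A period of the differences is a period of \<open>u\<close> up to one fixed
  complementation, read off at position 0. Summing differences gains one position, hence
  \<open>i \<le> n\<close>.\<close>

lemma diff_seq_period:
  assumes "\<forall>r<n. diff_seq u (r + q) = diff_seq u r" and "i \<le> n"
  shows "(u (i + q) \<noteq> u i) = (u q \<noteq> u 0)"
  using assms(2)
proof (induction i)
  case (Suc i)
  then have "diff_seq u (i + q) = diff_seq u i"
    using assms(1) by simp
  then show ?case
    using Suc by (auto simp: diff_seq_def)
qed simp

text \<open>With \<open>p = k + 1\<close> and \<open>q = l - k\<close>, the pair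
  \<open>(p, q)\<close> becomes \<open>(p + q, q)\<close> if the differences at \<open>k - 1\<close>
  and \<open>l - 1\<close> agree, and \<open>(p + q, p)\<close> otherwise; the border
  \<open>\<sigma>\<close> is \<open>k\<close> in the first case and \<open>l - k - 1\<close> in the
  second. The last two clauses of \<open>stage\<close> record the longest shorter length followed by
  the other difference, which identifies the border in the second case.\<close>

lemma stage_step:
  assumes "standard_sturmian (diff_seq u)" and st: "stage u k l"
  obtains l' where "stage u l l'"
    "l' = 2 * l - k \<and> (u (l - 1) \<noteq> u (l' - 1)) = (u (k - 1) \<noteq> u (l - 1)) \<or>
     l' = l + k + 1 \<and> (u (l - 1) \<noteq> u (l' - 1)) = (u (k - 1) = u 0)"
proof -
  let ?d = "diff_seq u"
  let ?L = "pal_lengths ?d"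
  note S = stageD[OF st]
  have kl: "k \<in> ?L" "l \<in> ?L" "k < l" "0 < k"
    using S(1) by (auto simp: consecutive_def pal_lengths_def)
  obtain \<sigma> where \<sigma>: "\<sigma> < l" "\<sigma> = 0 \<or> \<sigma> \<in> ?L \<and> ?d (\<sigma> - 1) = ?d (l - 1)"
    "\<forall>m\<in>?L. m < l \<and> ?d (m - 1) = ?d (l - 1) \<longrightarrow> m \<le> \<sigma>"
    "\<forall>r<l - 1. ?d (r + (l - \<sigma>)) = ?d r"
    "consecutive ?L l (2 * l - \<sigma>)"
    by (rule standard_sturmian.next_pal_length[OF assms(1) kl(2)])
  define l' where "l' = 2 * l - \<sigma>"
  have l': "l' - l = l - \<sigma>" "l' \<le> 2 * l" "l < l'" "2 * l - l' = \<sigma>"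
    using \<sigma>(1) by (simp_all add: l'_def)
  have shift: "(u (i + (l' - l)) \<noteq> u i) = (u (l - 1) \<noteq> u (l' - 1))" if "i < l" for i
  proof -
    have "l - 1 + (l' - l) = l' - 1"
      using kl l' by simp
    moreover have per: "\<forall>r<l - 1. diff_seq u (r + (l' - l)) = diff_seq u r"
      using \<sigma>(4) unfolding l'(1) .
    have "(u (i + (l' - l)) \<noteq> u i) = (u (l - 1 + (l' - l)) \<noteq> u (l - 1))"
      using diff_seq_period[OF per, of i] diff_seq_period[OF per, of "l - 1"] that by linarith
    ultimately show ?thesis
      by auto
  qed
  have le_k: "m \<le> k" if "m \<in> ?L" "m < l" for m
    using consecutiveD[OF S(1)] that by blast
  show thesis
  proof (cases "?d (l - 1) = ?d (k - 1)")
    case True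
    have "\<sigma> = k"
    proof (rule antisym)
      show "k \<le> \<sigma>"
        using \<sigma>(3) kl True by auto
      show "\<sigma> \<le> k"
        using \<sigma>(1,2) le_k by auto
    qed
    then have q: "l' - l = l - k" "l' = 2 * l - k"
      using l' l'_def by simp_all
    have flip: "(u (l - 1) \<noteq> u (l' - 1)) = (u (k - 1) \<noteq> u (l - 1))"
      using shift[of 0] S(5)[of 0] kl q by simp
    have cop: "coprime (l + 1) (l - k)"
    proof -
      have "l + 1 = (k + 1) + (l - k)"
        using kl by simp
      then show ?thesis
        using S(3) by (metis coprime_add_one_right coprime_iff_gcd_eq_1 gcd_add1)
    qed
    \<comment> \<open>The shift by \<open>l + 1\<close> is composed of those by \<open>k + 1\<close>
      and \<open>l - k\<close>; their complementations add modulo 2.\<close>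
    have sh: "(u (i + (l + 1)) \<noteq> u i) = (u (l - 1) = u 0)" if "i + (l + 1) < l'" for i
    proof -
      have i: "i + (k + 1) < l"
        using that q kl by linarith
      have eq: "i + (l + 1) = i + (k + 1) + (l' - l)"
        using q kl by simp
      have "(u (i + (l + 1)) \<noteq> u (i + (k + 1))) = (u (k - 1) \<noteq> u (l - 1))"
        unfolding eq using shift[OF i] flip by (rule trans)
      then show ?thesis
        using S(4)[OF i] by auto
    qed
    have types: "\<not> (u (l - 1) \<noteq> u 0 \<and> u (l' - 1) \<noteq> u 0)"
      using flip S(6) by auto
    have le_lk: "m \<le> l - k - 1" if "m \<in> ?L" "m < l" "?d (m - 1) \<noteq> ?d (l - 1)" for m
    proof -
      have "m < k"
        using le_k[of m] that True by (cases "m = k") auto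
      then show ?thesis
        using S(9) that True by auto
    qed
    have "stage u l l'"
    proof (rule stageI)
      show "consecutive ?L l l'" "l' \<le> 2 * l"
        using \<sigma>(5) l'(2) unfolding l'_def by blast+
      show "coprime (l + 1) (l' - l)"
        unfolding q(1) by (rule cop)
      show "m \<le> 2 * l - l'" if "m \<in> ?L" "m < l" "?d (m - 1) = ?d (l - 1)" for m
        unfolding l'(4) using \<sigma>(3) that by blast
      show "l' - l = 1 \<or> l' - l - 1 \<in> ?L \<and> ?d (l' - l - 2) \<noteq> ?d (l - 1)"
        unfolding q(1) True by (rule S(8))
      show "m \<le> l' - l - 1" if "m \<in> ?L" "m < l" "?d (m - 1) \<noteq> ?d (l - 1)" for m
        unfolding q(1) by (rule le_lk[OF that])
    qed (rule sh shift types; assumption)+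
    then show thesis
      using that q flip by blast
  next
    case False
    have "\<sigma> = l - k - 1"
    proof (rule antisym)
      show "\<sigma> \<le> l - k - 1"
      proof (cases "\<sigma> = 0")
        case neq: False
        then have "\<sigma> \<in> ?L" "?d (\<sigma> - 1) = ?d (l - 1)"
          using \<sigma>(2) by auto
        moreover have "\<sigma> < k"
          using le_k[of \<sigma>] \<sigma>(1) calculation False by (cases "\<sigma> = k") auto
        ultimately show ?thesis
          using S(9) False by auto
      qed simp
      show "l - k - 1 \<le> \<sigma>"
      proof (cases "l - k = 1")
        case neq: False
        then have *: "l - k - 1 \<in> ?L" "?d (l - k - 1 - 1) \<noteq> ?d (k - 1)"
          using S(8) by (auto simp: numeral_2_eq_2)
        then have "?d (l - k - 1 - 1) = ?d (l - 1)"
          using False by auto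
        moreover have "l - k - 1 < l"
          using kl by simp
        ultimately show ?thesis
          using \<sigma>(3) * by blast
      qed simp
    qed
    then have q: "l' - l = k + 1" "l' = l + k + 1"
      using l' kl by linarith+
    have flip: "(u (l - 1) \<noteq> u (l' - 1)) = (u (k - 1) = u 0)"
    proof (cases "k + 1 < l")
      case True
      then show ?thesis
        using shift[of 0] S(4)[of 0] kl q by simp
    next
      \<comment> \<open>Here \<open>l = k + 1\<close>, where the clause on the shift by
        \<open>k + 1\<close> is vacuous; the unequal differences at \<open>k - 1\<close> and
        \<open>k\<close> decide instead.\<close>
      case ge: False
      then have l: "l = k + 1"
        using kl by simp
      have "Suc (k - 1) = k"
        using kl by simp
      then have "u (l) \<noteq> u (k - 1)"
        using False l unfolding diff_seq_def by auto
      moreover have "(u (0 + (k + 1)) \<noteq> u 0) = (u (l - 1) \<noteq> u (l' - 1))"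
        using shift[of 0] kl q by simp
      ultimately show ?thesis
        using l by auto
    qed
    have cop: "coprime (l + 1) (k + 1)"
    proof -
      have "l + 1 = (k + 1) + (l - k)"
        using kl by simp
      then show ?thesis
        using S(3) by (metis coprime_commute coprime_iff_gcd_eq_1 gcd_add1 add.commute)
    qed
    have sh: "(u (i + (l + 1)) \<noteq> u i) = (u (l - 1) = u 0)" if "i + (l + 1) < l'" for i
    proof -
      have i: "i < k" "i + (l - k) < l"
        using that q kl by linarith+
      have eq: "i + (l + 1) = i + (l - k) + (l' - l)"
        using q kl by simp
      have "(u (i + (l + 1)) \<noteq> u (i + (l - k))) = (u (k - 1) = u 0)"
        unfolding eq using shift[OF i(2)] flip by (rule trans)
      then show ?thesis
        using S(5)[OF i(1)] by auto
    qed
    have types: "\<not> (u (l - 1) \<noteq> u 0 \<and> u (l' - 1) \<noteq> u 0)"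
      using flip S(6) by auto
    have "stage u l l'"
    proof (rule stageI)
      show "consecutive ?L l l'" "l' \<le> 2 * l"
        using \<sigma>(5) l'(2) unfolding l'_def by blast+
      show "coprime (l + 1) (l' - l)"
        unfolding q(1) by (rule cop)
      show "m \<le> 2 * l - l'" if "m \<in> ?L" "m < l" "?d (m - 1) = ?d (l - 1)" for m
        unfolding l'(4) using \<sigma>(3) that by blast
      show "l' - l = 1 \<or> l' - l - 1 \<in> ?L \<and> ?d (l' - l - 2) \<noteq> ?d (l - 1)"
        unfolding q(1) using kl False by simp
      show "m \<le> l' - l - 1" if "m \<in> ?L" "m < l" for m
        unfolding q(1) using le_k[OF that] by simp
    qed (rule sh shift types; assumption)+
    then show thesis
      using that q flip by blast
  qed
qed

section \<open>Attractors of words with two periods\<close>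

text \<open>The factor at the positions \<open>i\<close> to \<open>i + h\<close> is moved up by
  \<open>t\<close> until another move would leave the first \<open>N\<close> positions; the
  congruence keeps track of the residue.\<close>

lemma shift_to_top_window:
  fixes u :: "nat \<Rightarrow> 'a"
  assumes per: "\<And>i. i + t < N \<Longrightarrow> u (i + t) = u i" and "0 < t" and "i + h < N"
  shows "\<exists>j. j + h < N \<and> N \<le> j + h + t \<and> (\<forall>r\<le>h. u (j + r) = u (i + r)) \<and> [j = i] (mod t)"
  using \<open>i + h < N\<close>
proof (induction "N - i" arbitrary: i rule: less_induct)
  case less
  show ?case
  proof (cases "N \<le> i + h + t")
    case True
    then show ?thesis
      using less.prems by (intro exI[of _ i]) auto
  next
    case False
    then have *: "i + t + h < N"
      by simp
    then obtain j where j: "j + h < N" "N \<le> j + h + t" "\<forall>r\<le>h. u (j + r) = u (i + t + r)"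
      "[j = i + t] (mod t)"
      using less.hyps[of "i + t"] \<open>0 < t\<close> by (auto simp: diff_less_mono2)
    have "u (i + t + r) = u (i + r)" if "r \<le> h" for r
      using per[of "i + r"] * that by (simp add: ac_simps)
    moreover have "[j = i] (mod t)"
      using j(4) by (simp add: cong_def)
    ultimately show ?thesis
      using j by (intro exI[of _ j]) auto
  qed
qed

text \<open>
  A factor is shifted by multiples of \<open>2 * q\<close> until it lies in the last \<open>2 * q\<close> positions. If it then
  contains neither of the two positions, it reoccurs at a shift by \<open>- p\<close> modulo \<open>q\<close>, and as \<open>p\<close> and
  \<open>q\<close> are coprime its last position eventually becomes congruent to \<open>p - 1\<close>.
\<close>

lemma attractor_two_periods_aux:
  fixes u :: "nat \<Rightarrow> bool"
  assumes q: "0 < q" "q < p"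
    and pa: "\<And>i. i + p < p + q - 1 \<Longrightarrow> (u (i + p) \<noteq> u i) = \<alpha>"
    and qa: "\<And>i. i + q < p + q - 1 \<Longrightarrow> u (i + q) \<noteq> u i"
    and "i + h < p + q - 1" and "[i + h + 1 = (\<kappa> + 1) * p] (mod q)"
  shows "\<exists>s. s + h < p + q - 1 \<and> (\<forall>r\<le>h. u (s + r) = u (i + r)) \<and>
    (\<exists>g\<in>{p - q - 1, p - 1}. s \<le> g \<and> g \<le> s + h)"
  using assms(5,6)
proof (induction \<kappa> arbitrary: i)
  let ?N = "p + q - 1"
  \<comment> \<open>Two shifts by \<open>q\<close> cancel their complementations, so
    \<open>2 * q\<close> is a true period.\<close>
  have top: "\<exists>j. j + h < ?N \<and> ?N \<le> j + h + 2 * q \<and> (\<forall>r\<le>h. u (j + r) = u (i + r)) \<and>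
      [j = i] (mod q)" if ih: "i + h < ?N" for i
  proof -
    have "u (i + 2 * q) = u i" if "i + 2 * q < ?N" for i
      using qa[of i] qa[of "i + q"] that by (auto simp: mult_2 add.assoc)
    then obtain j where "j + h < ?N" "?N \<le> j + h + 2 * q" "\<forall>r\<le>h. u (j + r) = u (i + r)"
      "[j = i] (mod (2 * q))"
      using shift_to_top_window[of "2 * q" ?N u i h] q ih by auto
    then show ?thesis
      using cong_modulus_mult_nat[of j i q 2] by (auto simp: mult.commute)
  qed
  {
    case 0
    obtain j where j: "j + h < ?N" "?N \<le> j + h + 2 * q" "\<forall>r\<le>h. u (j + r) = u (i + r)"
      and ji: "[j = i] (mod q)"
      using top[OF 0(1)] by blast
    have "[j + h + 1 = i + h + 1] (mod q)"
      using ji by (intro cong_add) auto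
    also have "[i + h + 1 = p] (mod q)"
      using 0(2) by simp
    finally have c: "[j + h + 1 = p] (mod q)" .
    \<comment> \<open>The last position is congruent to \<open>p - 1\<close> modulo \<open>q\<close>
      and lies among the top \<open>2 * q\<close> positions, which start at
      \<open>p - q - 1\<close>; two values remain.\<close>
    have "j + h = p - 1 \<or> j + h = p - q - 1"
    proof (cases "j + h + 1 < p")
      case True
      then have "q dvd p - (j + h + 1)"
        using cong_altdef_nat[of "j + h + 1" p q] cong_sym[OF c] by simp
      moreover have "p - (j + h + 1) \<le> q"
        using j(2) True by linarith
      moreover have "0 < p - (j + h + 1)"
        using True by simp
      ultimately have "p - (j + h + 1) = q"
        using dvd_imp_le le_antisym by blast
      then have "j + h = p - q - 1"
        using True by linarith
      then show ?thesis ..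
    next
      case False
      then have "q dvd (j + h + 1) - p"
        using cong_altdef_nat[of p "j + h + 1" q] c by simp
      moreover have "(j + h + 1) - p < q"
        using j(1) False by linarith
      ultimately have "(j + h + 1) - p = 0"
        using nat_dvd_not_less[of "(j + h + 1) - p" q] by linarith
      then have "j + h = p - 1"
        using False by linarith
      then show ?thesis ..
    qed
    then show ?case
      using j by (intro exI[of _ j]) auto
  next
    case (Suc \<kappa>)
    obtain j where j: "j + h < ?N" "?N \<le> j + h + 2 * q" "\<forall>r\<le>h. u (j + r) = u (i + r)"
      and ji: "[j = i] (mod q)"
      using top[OF Suc.prems(1)] by blast
    show ?case
    proof (cases "\<exists>g\<in>{p - q - 1, p - 1}. j \<le> g \<and> g \<le> j + h")
      case True
      then show ?thesis
        using j by (intro exI[of _ j]) auto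
    next
      case False
      \<comment> \<open>If \<open>p \<le> j\<close>, the shift is \<open>- p\<close>; otherwise the
        factor lies strictly between the two positions and the shift is \<open>q - p\<close>.
        Another \<open>q\<close> is added when the number of complementations would be odd.\<close>
      have "\<exists>k. k + h < ?N \<and> (\<forall>r\<le>h. u (k + r) = u (j + r)) \<and>
        (k + p = j \<or> k + p = j + q \<or> k + p = j + 2 * q)"
      proof (cases "p \<le> j")
        case True
        define k where "k = j - p"
        have k: "j = k + p"
          using True by (simp add: k_def)
        have 1: "(u (k + p + r) \<noteq> u (k + r)) = \<alpha>" if "r \<le> h" for r
          using pa[of "k + r"] j(1) that unfolding k by (simp add: ac_simps)
        show ?thesis
        proof (cases \<alpha>)
          case True
          have "u (k + q + r) \<noteq> u (k + r)" if "r \<le> h" for r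
            using qa[of "k + r"] j(1) that q unfolding k by (simp add: ac_simps)
          then show ?thesis
            using 1 True j(1) q unfolding k by (intro exI[of _ "k + q"]) auto
        next
          case False
          then show ?thesis
            using 1 j(1) q unfolding k by (intro exI[of _ k]) auto
        qed
      next
        case False
        then have "j + h < p - 1" "p - q \<le> j"
          using \<open>\<not> (\<exists>g\<in>{p - q - 1, p - 1}. j \<le> g \<and> g \<le> j + h)\<close> j(2) q by auto
        define k where "k = j + q - p"
        have k: "j + q = k + p"
          using \<open>p - q \<le> j\<close> q by (simp add: k_def)
        have b: "k + p + h < ?N" "k + h + q < ?N"
          using \<open>j + h < p - 1\<close> k q by linarith+
        have 1: "u (k + p + r) \<noteq> u (j + r)" if "r \<le> h" for r
        proof -
          have eq: "j + r + q = k + p + r"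
            using k by linarith
          have "j + r + q < ?N"
            using b that eq by linarith
          from qa[OF this] show ?thesis
            unfolding eq .
        qed
        have 2: "(u (k + p + r) \<noteq> u (k + r)) = \<alpha>" if "r \<le> h" for r
        proof -
          have eq: "k + r + p = k + p + r"
            using k by linarith
          have "k + r + p < ?N"
            using b that eq by linarith
          from pa[OF this] show ?thesis
            unfolding eq .
        qed
        show ?thesis
        proof (cases \<alpha>)
          case True
          then show ?thesis
            using 1 2 b k by (intro exI[of _ k]) simp
        next
          case False
          have "u (k + q + r) \<noteq> u (k + r)" if "r \<le> h" for r
          proof -
            have eq: "k + r + q = k + q + r"
              using k by linarith
            have "k + r + q < ?N"
              using b that eq by linarith
            from qa[OF this] show ?thesis
              unfolding eq .
          qed
          then have "\<forall>r\<le>h. u (k + q + r) = u (j + r)"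
            using 1 2 False by blast
          moreover have "k + q + h < ?N" "k + q + p = j + 2 * q"
            using b k by linarith+
          ultimately show ?thesis
            by blast
        qed
      qed
      then obtain k where k: "k + h < ?N" "\<forall>r\<le>h. u (k + r) = u (j + r)"
        "k + p = j \<or> k + p = j + q \<or> k + p = j + 2 * q"
        by blast
      have "[k + p = j] (mod q)"
        using k(3) by (auto simp: cong_def)
      then have "[k + p = i] (mod q)"
        using ji cong_trans by blast
      then have "[k + p + (h + 1) = i + (h + 1)] (mod q)"
        by (rule cong_add) simp
      also have "i + (h + 1) = i + h + 1"
        by simp
      also have "[\<dots> = (Suc \<kappa> + 1) * p] (mod q)"
        by (rule Suc.prems(2))
      finally have "[k + h + 1 + p = (\<kappa> + 1) * p + p] (mod q)"
        by (simp add: ac_simps)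
      then have "[k + h + 1 = (\<kappa> + 1) * p] (mod q)"
        by (simp only: cong_add_rcancel_nat)
      from Suc.IH[OF k(1) this] obtain s where "s + h < ?N" "\<forall>r\<le>h. u (s + r) = u (k + r)"
        "\<exists>g\<in>{p - q - 1, p - 1}. s \<le> g \<and> g \<le> s + h"
        by blast
      then show ?thesis
        using k j by (intro exI[of _ s]) auto
    qed
  }
qed

text \<open>The attractor condition for a prefix, by positions: \<open>h\<close> is the length of
  the factor minus one, which restricts it to non-empty factors. The inclusion of
  \<open>\<Gamma>\<close> in the positions of the word is kept apart.\<close>

definition attracts :: "(nat \<Rightarrow> bool) \<Rightarrow> nat \<Rightarrow> nat set \<Rightarrow> bool"
  where "attracts u N \<Gamma> \<longleftrightarrow> (\<forall>i h. i + h < N \<longrightarrow>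
    (\<exists>s. s + h < N \<and> (\<forall>r\<le>h. u (s + r) = u (i + r)) \<and> (\<exists>g\<in>\<Gamma>. s \<le> g \<and> g \<le> s + h)))"

lemma attracts_two_periods:
  fixes u :: "nat \<Rightarrow> bool"
  assumes q: "0 < q" "q < p" "coprime p q"
    and "\<And>i. i + p < p + q - 1 \<Longrightarrow> (u (i + p) \<noteq> u i) = \<alpha>"
    and "\<And>i. i + q < p + q - 1 \<Longrightarrow> u (i + q) \<noteq> u i"
  shows "attracts u (p + q - 1) {p - q - 1, p - 1}"
  unfolding attracts_def
proof (intro allI impI)
  fix i h
  assume ih: "i + h < p + q - 1"
  \<comment> \<open>\<open>x\<close> inverts \<open>p\<close> modulo \<open>q\<close>, so
    \<open>i + h + 1\<close> is congruent to a multiple of \<open>p\<close>. Adding \<open>q\<close>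
    to the multiplier gives it the form \<open>\<kappa> + 1\<close>.\<close>
  obtain x where x: "[p * x = 1] (mod q)"
    using cong_solve_coprime_nat[OF q(3)] by auto
  have "[p * x * (i + h + 1) = 1 * (i + h + 1)] (mod q)"
    using x by (rule cong_mult) simp
  moreover have "[(x * (i + h + 1) + (q - 1) + 1) * p = p * x * (i + h + 1)] (mod q)"
  proof -
    have "(x * (i + h + 1) + (q - 1) + 1) * p = p * x * (i + h + 1) + q * p"
      using q by (simp add: algebra_simps)
    then show ?thesis
      by (simp add: cong_def)
  qed
  ultimately have "[i + h + 1 = (x * (i + h + 1) + (q - 1) + 1) * p] (mod q)"
    by (metis cong_sym cong_trans mult_1)
  then show "\<exists>s. s + h < p + q - 1 \<and> (\<forall>r\<le>h. u (s + r) = u (i + r)) \<and>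
      (\<exists>g\<in>{p - q - 1, p - 1}. s \<le> g \<and> g \<le> s + h)"
    using attractor_two_periods_aux[of q p u \<alpha> i h] assms ih by blast
qed

text \<open>A factor starting at \<open>p\<close> or later moves down by \<open>p\<close>. One
  starting earlier lies in the first \<open>N\<close> positions or runs past them, and then covers
  \<open>p - 1\<close>.\<close>

lemma attracts_period_extend:
  fixes u :: "nat \<Rightarrow> bool"
  assumes "attracts u N \<Gamma>" "N \<le> N'" "0 < p" "p - 1 \<in> \<Gamma>" "p \<le> N"
    and per: "\<And>i. i + p < N' \<Longrightarrow> u (i + p) = u i"
  shows "attracts u N' \<Gamma>"
  unfolding attracts_def
proof (intro allI impI)
  fix i h
  assume "i + h < N'"
  then show "\<exists>s. s + h < N' \<and> (\<forall>r\<le>h. u (s + r) = u (i + r)) \<and> (\<exists>g\<in>\<Gamma>. s \<le> g \<and> g \<le> s + h)"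
  proof (induction i rule: less_induct)
    case (less i)
    show ?case
    proof (cases "i < p")
      case True
      show ?thesis
      proof (cases "i + h < N")
        case True
        then show ?thesis
          using assms(1,2) unfolding attracts_def by (meson order_less_le_trans)
      next
        case False
        then show ?thesis
          using True less.prems assms(4,5)
          by (intro exI[of _ i] conjI bexI[of _ "p - 1"]) auto
      qed
    next
      case False
      have "u (i - p + r) = u (i + r)" if "r \<le> h" for r
        using per[of "i - p + r"] that less.prems False by simp
      then show ?thesis
        using less.IH[of "i - p"] less.prems False \<open>0 < p\<close> by auto
    qed
  qed
qed

lemma attractor_subsequence:
  assumes "attracts u N \<Gamma>" "\<Gamma> \<subseteq> {0..<N}"
  shows "attractor \<Gamma> (u [0 \<rightarrow> N])"
  unfolding attractor_def
proof (intro conjI allI impI)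
  show "\<Gamma> \<subseteq> {0..<length (u [0 \<rightarrow> N])}"
    using assms by simp
  fix v :: "bool list"
  assume v: "v \<noteq> [] \<and> sublist v (u [0 \<rightarrow> N])"
  then obtain xs ys where eq: "u [0 \<rightarrow> N] = xs @ v @ ys"
    by (auto simp: sublist_def)
  define i h where "i = length xs" and "h = length v - 1"
  have len: "length v = Suc h" "N = i + Suc h + length ys"
    using v arg_cong[OF eq, of length] by (auto simp: i_def h_def)
  have v_nth: "v ! r = u (i + r)" if "r \<le> h" for r
  proof -
    have "v ! r = (xs @ v @ ys) ! (i + r)"
      using that len by (simp add: i_def nth_append)
    also have "\<dots> = u (i + r)"
      unfolding eq[symmetric] using that len by (subst subsequence_nth) auto
    finally show ?thesis .
  qed
  obtain s g where s: "s + h < N" "\<forall>r\<le>h. u (s + r) = u (i + r)" "g \<in> \<Gamma>" "s \<le> g" "g \<le> s + h"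
    using assms(1)[unfolded attracts_def, rule_format, of i h] len by auto
  have "v = u [s \<rightarrow> s + Suc h]"
  proof (rule nth_equalityI)
    fix r
    assume "r < length v"
    then show "v ! r = u [s \<rightarrow> s + Suc h] ! r"
      using len v_nth[of r] s(2) by (subst subsequence_nth) auto
  qed (use len in simp)
  also have "\<dots> = take (s + Suc h - s) (drop s (u [0 \<rightarrow> N]))"
    using s(1) by simp
  finally have "v = take (s + Suc h - s) (drop s (u [0 \<rightarrow> N]))" .
  moreover have "s + Suc h \<le> length (u [0 \<rightarrow> N])" "g \<in> {s..<s + Suc h} \<inter> \<Gamma>"
    using s by simp_all
  ultimately show "\<exists>i j. i \<le> j \<and> j \<le> length (u [0 \<rightarrow> N]) \<and>
      v = take (j - i) (drop i (u [0 \<rightarrow> N])) \<and> {i..<j} \<inter> \<Gamma> \<noteq> {}"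
    by (metis empty_iff le_add1)
qed

text \<open>Each letter is a factor of length one, so it must stand at a position in
  \<open>\<Gamma>\<close>.\<close>

lemma attractor_card_ge:
  assumes "attractor \<Gamma> w"
  shows "card (set w) \<le> card \<Gamma>"
proof -
  have fin: "finite \<Gamma>"
    using assms finite_subset unfolding attractor_def by blast
  have "set w \<subseteq> (\<lambda>i. w ! i) ` \<Gamma>"
  proof
    fix x
    assume "x \<in> set w"
    then have "sublist [x] w"
      by (metis append_Cons append_Nil split_list sublist_def)
    then obtain i j where ij: "i \<le> j" "j \<le> length w" "[x] = take (j - i) (drop i w)"
      "{i..<j} \<inter> \<Gamma> \<noteq> {}"
      using assms unfolding attractor_def by blast
    have "length (take (j - i) (drop i w)) = 1"
      using ij(3) by (metis length_Cons list.size(3) One_nat_def)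
    then have "j = Suc i"
      using ij by auto
    then have "i \<in> \<Gamma>"
      using ij(4) by auto
    moreover have "w ! i = x"
      using ij(2,3) \<open>j = Suc i\<close> by (auto simp: take_Suc_conv_app_nth hd_drop_conv_nth[symmetric] take_Suc)
    ultimately show "x \<in> (\<lambda>i. w ! i) ` \<Gamma>"
      by blast
  qed
  then show ?thesis
    using fin by (meson card_image_le card_mono finite_imageI order_trans)
qed

section \<open>Attractors of pseudopalindromic prefixes\<close>

lemma set_subsequence: "set (u [0 \<rightarrow> l]) = u ` {..<l}"
  by (auto simp: subsequence_def)

text \<open>The form \<open>(u i \<noteq> u j) = False\<close> makes palindromes and antipalindromes
  instances of one condition, differing in a truth value.\<close>

lemma palindrome_subsequence_iff:
  "palindrome (u [0 \<rightarrow> l]) \<longleftrightarrow> (\<forall>i j. i + j + 1 = l \<longrightarrow> (u i \<noteq> u j) = False)"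
  (is "?P \<longleftrightarrow> ?Q")
proof -
  have "?P \<longleftrightarrow> (\<forall>i<l. u i = u (l - Suc i))"
    by (auto simp: palindrome_def list_eq_iff_nth_eq rev_nth)
  also have "\<dots> \<longleftrightarrow> ?Q"
  proof
    assume *: "\<forall>i<l. u i = u (l - Suc i)"
    show ?Q
    proof (intro allI impI)
      fix i j
      assume "i + j + 1 = l"
      then show "(u i \<noteq> u j) = False"
        using *[rule_format, of i] by auto
    qed
  next
    assume *: ?Q
    show "\<forall>i<l. u i = u (l - Suc i)"
      using *[rule_format, of _ "l - Suc _"] by auto
  qed
  finally show ?thesis .
qed

lemma antipalindrome_subsequence_iff:
  "antipalindrome (u [0 \<rightarrow> l]) \<longleftrightarrow> (\<forall>i j. i + j + 1 = l \<longrightarrow> (u i \<noteq> u j) = True)"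
  (is "?P \<longleftrightarrow> ?Q")
proof -
  have "?P \<longleftrightarrow> (\<forall>i<l. u i \<noteq> u (l - Suc i))"
    by (auto simp: antipalindrome_def exchange_def complement_def list_eq_iff_nth_eq rev_nth)
  also have "\<dots> \<longleftrightarrow> ?Q"
  proof
    assume *: "\<forall>i<l. u i \<noteq> u (l - Suc i)"
    show ?Q
    proof (intro allI impI)
      fix i j
      assume "i + j + 1 = l"
      then show "(u i \<noteq> u j) = True"
        using *[rule_format, of i] by auto
    qed
  next
    assume *: ?Q
    show "\<forall>i<l. u i \<noteq> u (l - Suc i)"
      using *[rule_format, of _ "l - Suc _"] by auto
  qed
  finally show ?thesis .
qed

text \<open>Moving \<open>i\<close> up and \<open>j\<close> down by one flips both letters or
  neither, as the differences passed are equal; so the comparison of the end letters propagates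
  inward.\<close>

lemma pal_prefix_diff_seqD:
  assumes "pal_prefix (diff_seq u) (l - 1)" "i + j + 1 = l"
  shows "(u i \<noteq> u j) = (u (l - 1) \<noteq> u 0)"
  using assms(2)
proof (induction i arbitrary: j)
  case 0
  then show ?case
    by auto
next
  case (Suc i)
  have "diff_seq u i = diff_seq u j"
    by (rule pal_prefixD[OF assms(1)]) (use Suc.prems in simp)
  moreover have "(u i \<noteq> u (Suc j)) = (u (l - 1) \<noteq> u 0)"
    using Suc by simp
  ultimately show ?case
    by (auto simp: diff_seq_def)
qed

lemma mem_pal_lengths_diff_seqI:
  assumes "0 < l" "\<And>i j. i + j + 1 = l \<Longrightarrow> (u i \<noteq> u j) = e"
  shows "l \<in> pal_lengths (diff_seq u)"
  unfolding pal_lengths_def pal_prefix_def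
proof (intro CollectI conjI allI impI)
  fix i j
  assume "i + j + 1 = l - 1"
  then have "(u i \<noteq> u (Suc j)) = e" "(u (Suc i) \<noteq> u j) = e"
    by (intro assms(2), simp)+
  then show "diff_seq u i = diff_seq u j"
    by (auto simp: diff_seq_def)
qed (rule assms(1))

lemma palindrome_iff:
  assumes "l \<in> pal_lengths (diff_seq u)"
  shows "palindrome (u [0 \<rightarrow> l]) \<longleftrightarrow> u (l - 1) = u 0"
    and "antipalindrome (u [0 \<rightarrow> l]) \<longleftrightarrow> u (l - 1) \<noteq> u 0"
proof -
  have l: "0 < l" "pal_prefix (diff_seq u) (l - 1)"
    using assms by (auto simp: pal_lengths_def)
  have *: "(\<forall>i j. i + j + 1 = l \<longrightarrow> (u i \<noteq> u j) = e) \<longleftrightarrow> (u (l - 1) \<noteq> u 0) = e" for e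
  proof
    assume "\<forall>i j. i + j + 1 = l \<longrightarrow> (u i \<noteq> u j) = e"
    moreover have "l - 1 + 0 + 1 = l"
      using l by simp
    ultimately show "(u (l - 1) \<noteq> u 0) = e"
      by blast
  next
    assume "(u (l - 1) \<noteq> u 0) = e"
    then show "\<forall>i j. i + j + 1 = l \<longrightarrow> (u i \<noteq> u j) = e"
      using pal_prefix_diff_seqD[OF l(2)] by blast
  qed
  show "palindrome (u [0 \<rightarrow> l]) \<longleftrightarrow> u (l - 1) = u 0"
    unfolding palindrome_subsequence_iff * by simp
  show "antipalindrome (u [0 \<rightarrow> l]) \<longleftrightarrow> u (l - 1) \<noteq> u 0"
    unfolding antipalindrome_subsequence_iff * by simp
qed

lemma pseudopal_lengths_eq: "pseudopal_lengths u = pal_lengths (diff_seq u)"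
proof (rule set_eqI)
  fix l
  show "l \<in> pseudopal_lengths u \<longleftrightarrow> l \<in> pal_lengths (diff_seq u)"
  proof
    assume "l \<in> pseudopal_lengths u"
    then show "l \<in> pal_lengths (diff_seq u)"
      unfolding pseudopal_lengths_def pseudopalindrome_def palindrome_subsequence_iff
        antipalindrome_subsequence_iff
      using mem_pal_lengths_diff_seqI[of l u] by blast
  next
    assume "l \<in> pal_lengths (diff_seq u)"
    then show "l \<in> pseudopal_lengths u"
      using palindrome_iff[of l u]
      by (auto simp: pseudopal_lengths_def pseudopalindrome_def pal_lengths_def)
  qed
qed

lemma followed_by_subsequence_iff:
  "followed_by v c (u [0 \<rightarrow> l]) \<longleftrightarrow> (\<exists>m<l. v = u [0 \<rightarrow> m] \<and> u m = c)"
proof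
  assume "followed_by v c (u [0 \<rightarrow> l])"
  then have pre: "prefix (v @ [c]) (u [0 \<rightarrow> l])"
    by (simp add: followed_by_def)
  then have len: "length v < l"
    using prefix_length_le by fastforce
  have "v @ [c] = take (length (v @ [c])) (u [0 \<rightarrow> l])"
    using pre by (metis append_eq_conv_conj prefixE)
  also have "\<dots> = u [0 \<rightarrow> Suc (length v)]"
    using len by (simp add: min_def)
  also have "\<dots> = u [0 \<rightarrow> length v] @ [u (length v)]"
    by simp
  finally show "\<exists>m<l. v = u [0 \<rightarrow> m] \<and> u m = c"
    using len by auto
next
  assume "\<exists>m<l. v = u [0 \<rightarrow> m] \<and> u m = c"
  then obtain m where m: "m < l" "v = u [0 \<rightarrow> m]" "u m = c"
    by blast
  have "v @ [c] = u [0 \<rightarrow> Suc m]"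
    using m by simp
  moreover have "take (Suc m) (u [0 \<rightarrow> l]) = u [0 \<rightarrow> Suc m]"
    using m(1) by (simp add: min_def)
  ultimately show "followed_by v c (u [0 \<rightarrow> l])"
    unfolding followed_by_def by (metis take_is_prefix)
qed

text \<open>When the type changes, the shift by \<open>q = l - k\<close> complements. With
  \<open>p = k + 1\<close>, the positions \<open>p - q - 1\<close> and \<open>p - 1\<close> are
  \<open>2 * k - l\<close> and \<open>k\<close>.\<close>

lemma stage_attracts:
  assumes st: "stage u k l" and flip: "u (k - 1) \<noteq> u (l - 1)"
  shows "attracts u l {2 * k - l, k}"
proof -
  note S = stageD[OF st]
  have kl: "k < l"
    using S(1) by (simp add: consecutive_def)
  have eq: "(k + 1) + (l - k) - 1 = l" "k + 1 - (l - k) - 1 = 2 * k - l" "k + 1 - 1 = k"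
    using kl S(2) by simp_all
  have "attracts u ((k + 1) + (l - k) - 1) {k + 1 - (l - k) - 1, k + 1 - 1}"
  proof (rule attracts_two_periods)
    show "0 < l - k" "l - k < k + 1" "coprime (k + 1) (l - k)"
      using kl S(2,3) by auto
    show "(u (i + (k + 1)) \<noteq> u i) = (u (k - 1) = u 0)" if "i + (k + 1) < k + 1 + (l - k) - 1" for i
      using that unfolding eq by (rule S(4))
    show "u (i + (l - k)) \<noteq> u i" if "i + (l - k) < k + 1 + (l - k) - 1" for i
      using S(5)[of i] that flip kl by auto
  qed
  then show ?thesis
    unfolding eq .
qed

text \<open>\<open>P\<close> is the type of the prefix of length \<open>l\<close>. Two shifts by
  \<open>l - k\<close> change no letter, so removing the last \<open>2 * (l - k)\<close> letters
  keeps the type; one shift takes position \<open>2 * k - l\<close> to \<open>k\<close> and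
  complements, which gives the following letter.\<close>

lemma stage_longest_followed_by:
  assumes st: "stage u k l" and flip: "u (k - 1) \<noteq> u (l - 1)"
    and P: "\<And>m. P (u [0 \<rightarrow> m]) \<longleftrightarrow>
      (\<forall>i j. i + j + 1 = m \<longrightarrow> (u i \<noteq> u j) = (u (l - 1) \<noteq> u 0))"
  shows "longest_followed_by P (\<not> u k) (u [0 \<rightarrow> l]) (u [0 \<rightarrow> 2 * k - l])"
  unfolding longest_followed_by_def
proof (intro conjI allI impI)
  note S = stageD[OF st]
  let ?L = "pal_lengths (diff_seq u)"
  have kl: "k < l" "0 < k" "k \<in> ?L" "l \<in> ?L"
    using S(1) by (auto simp: consecutive_def pal_lengths_def)
  have shift: "u (i + (l - k)) \<noteq> u i" if "i < k" for i
    using S(5)[OF that] flip by blast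
  have pal: "pal_prefix (diff_seq u) (l - 1)"
    using kl by (simp add: pal_lengths_def)
  show "P (u [0 \<rightarrow> 2 * k - l])"
    unfolding P
  proof (intro allI impI)
    fix i j
    assume ij: "i + j + 1 = 2 * k - l"
    then have "j < k" "j + (l - k) < k"
      using kl by linarith+
    then have "u (j + (l - k) + (l - k)) = u j"
      using shift by blast
    moreover have "(u i \<noteq> u (j + (l - k) + (l - k))) = (u (l - 1) \<noteq> u 0)"
      by (rule pal_prefix_diff_seqD[OF pal]) (use ij kl in linarith)
    ultimately show "(u i \<noteq> u j) = (u (l - 1) \<noteq> u 0)"
      by simp
  qed
  have "u (2 * k - l + (l - k)) \<noteq> u (2 * k - l)"
    by (rule shift) (use kl in linarith)
  moreover have "2 * k - l + (l - k) = k"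
    using kl S(2) by linarith
  ultimately have "u (2 * k - l) = (\<not> u k)"
    by auto
  then show "followed_by (u [0 \<rightarrow> 2 * k - l]) (\<not> u k) (u [0 \<rightarrow> l])"
    unfolding followed_by_subsequence_iff
    by (intro exI[of _ "2 * k - l"]) (use kl in auto)
  fix v
  assume "P v \<and> followed_by v (\<not> u k) (u [0 \<rightarrow> l])"
  then obtain m where m: "m < l" "v = u [0 \<rightarrow> m]" "u m = (\<not> u k)" "P (u [0 \<rightarrow> m])"
    unfolding followed_by_subsequence_iff by auto
  have "m \<le> 2 * k - l"
  proof (cases "m = 0")
    case False
    have mL: "m \<in> ?L"
      using m(4) False unfolding P by (intro mem_pal_lengths_diff_seqI) auto
    then have "m \<le> k"
      using consecutiveD[OF S(1)] m(1) by blast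
    then have "m < k"
      using m(3) by (cases "m = k") auto
    \<comment> \<open>A competitor ends and continues oppositely to the prefix of length
      \<open>k\<close>, hence is followed by the same difference and bounded by
      \<open>stage\<close>.\<close>
    have "(u 0 \<noteq> u (m - 1)) = (u (l - 1) \<noteq> u 0)"
      using m(4) False unfolding P by simp
    then have "u (m - 1) \<noteq> u (k - 1)"
      using flip by auto
    then have "diff_seq u (m - 1) = diff_seq u (k - 1)"
      using m(3) False kl(2) by (auto simp: diff_seq_def)
    then show ?thesis
      using S(7) mL \<open>m < k\<close> by blast
  qed simp
  then show "length v \<le> length (u [0 \<rightarrow> 2 * k - l])"
    using m(2) by simp
qed

lemma minimal_attractor_pair:
  assumes "attractor {x, y} w" "{False, True} \<subseteq> set w"
  shows "minimal_attractor {x, y} w"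
  unfolding minimal_attractor_def
proof (intro conjI allI impI)
  fix \<Delta>
  assume "attractor \<Delta> w"
  then have "card (set w) \<le> card \<Delta>"
    by (rule attractor_card_ge)
  moreover have "card {False, True} \<le> card (set w)"
    using assms(2) by (intro card_mono) auto
  moreover have "card {x, y} \<le> 2"
    by (simp add: card_insert_if)
  ultimately show "card {x, y} \<le> card \<Delta>"
    by simp
qed (rule assms(1))

section \<open>The enumerated pseudopalindromic prefixes and their types\<close>

locale standard_rote =
  fixes u :: "nat \<Rightarrow> bool"
  assumes std: "standard_cs_rote u"
begin

text \<open>Indices count from 0: index \<open>n\<close> belongs to the prefix numbered
  \<open>n + 1\<close>.\<close>

abbreviation pp_length :: "nat \<Rightarrow> nat"
  where "pp_length \<equiv> enumerate (pseudopal_lengths u)"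

abbreviation anti :: "nat \<Rightarrow> bool"
  where "anti n \<equiv> u (pp_length n - 1) \<noteq> u 0"

lemma infinite_pseudopal_lengths: "infinite (pseudopal_lengths u)"
proof -
  have "\<exists>k l. stage u k l \<and> n < l" for n
  proof (induction n)
    case 0
    show ?case
      using stage_base by (intro exI[of _ 1] exI[of _ 2]) simp
  next
    case (Suc n)
    then obtain k l where kl: "stage u k l" "n < l"
      by blast
    obtain l' where "stage u l l'"
      using stage_step[OF standard_sturmian_diff_seq[OF std] kl(1)] by blast
    moreover have "l < l'"
      using stageD(1)[OF \<open>stage u l l'\<close>] by (simp add: consecutive_def)
    ultimately show ?case
      using kl(2) by (intro exI[of _ l] exI[of _ l']) simp
  qed
  then have "\<forall>n. \<exists>l>n. l \<in> pseudopal_lengths u"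
    using stageD(1) unfolding pseudopal_lengths_eq consecutive_def by blast
  then show ?thesis
    by (simp add: infinite_nat_iff_unbounded)
qed

lemma pp_length_mem: "pp_length n \<in> pal_lengths (diff_seq u)"
  using enumerate_in_set[OF infinite_pseudopal_lengths] unfolding pseudopal_lengths_eq .

lemma pp_length_0: "pp_length 0 = 1"
proof -
  have "1 \<in> pseudopal_lengths u"
    unfolding pseudopal_lengths_eq by (simp add: pal_lengths_def)
  then show ?thesis
    unfolding enumerate_0
    by (intro Least_equality) (auto simp: pseudopal_lengths_def)
qed

lemma pp_length_Suc:
  assumes "stage u (pp_length n) l"
  shows "pp_length (Suc n) = l"
  unfolding enumerate_Suc''[OF infinite_pseudopal_lengths]
proof (rule Least_equality)
  note c = stageD(1)[OF assms, folded pseudopal_lengths_eq]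
  show "l \<in> pseudopal_lengths u \<and> pp_length n < l"
    using c by (simp add: consecutive_def)
  show "l \<le> m" if "m \<in> pseudopal_lengths u \<and> pp_length n < m" for m
    using c that by (auto simp: consecutive_def not_less)
qed

lemma stage_pp_length: "stage u (pp_length n) (pp_length (Suc n))"
proof (induction n)
  case 0
  have "stage u (pp_length 0) 2"
    unfolding pp_length_0 by (rule stage_base)
  then show ?case
    using pp_length_Suc by simp
next
  case (Suc n)
  then obtain l' where "stage u (pp_length (Suc n)) l'"
    using stage_step[OF standard_sturmian_diff_seq[OF std]] by blast
  then show ?case
    using pp_length_Suc by simp
qed

lemma pp_length_less: "pp_length n < pp_length (Suc n)"
  using stageD(1)[OF stage_pp_length] by (simp add: consecutive_def)

text \<open>\<open>stage_step\<close> in terms of increments: either the increment and its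
  complementation persist, or the other period \<open>k n + 1\<close> becomes the increment and
  brings its own complementation.\<close>

lemma pp_length_step:
  defines "k \<equiv> pp_length" and "t \<equiv> \<lambda>n. u (pp_length n - 1)"
  shows "k (Suc (Suc n)) - k (Suc n) = k (Suc n) - k n \<and>
      (t (Suc n) \<noteq> t (Suc (Suc n))) = (t n \<noteq> t (Suc n)) \<or>
    k (Suc (Suc n)) - k (Suc n) = k n + 1 \<and> (t (Suc n) \<noteq> t (Suc (Suc n))) = (t n = u 0)"
proof -
  obtain l' where l': "stage u (k (Suc n)) l'"
    "l' = 2 * k (Suc n) - k n \<and> (u (k (Suc n) - 1) \<noteq> u (l' - 1)) = (t n \<noteq> t (Suc n)) \<or>
     l' = k (Suc n) + k n + 1 \<and> (u (k (Suc n) - 1) \<noteq> u (l' - 1)) = (t n = u 0)"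
    using stage_step[OF standard_sturmian_diff_seq[OF std] stage_pp_length[of n]]
    unfolding k_def t_def by blast
  have "k (Suc (Suc n)) = l'"
    using pp_length_Suc l'(1) unfolding k_def by blast
  moreover have "k n < k (Suc n)"
    unfolding k_def by (rule pp_length_less)
  ultimately show ?thesis
    using l'(2) unfolding t_def k_def by auto
qed

text \<open>The increments start at 1. Replacing the increment would use a complementing shift and
  produce an antipalindrome, so it stays 1 and never complements.\<close>

lemma constant_if_no_antipalindrome:
  assumes "\<And>j. j \<le> n \<Longrightarrow> \<not> anti j" and "i < pp_length n"
  shows "u i = u 0"
proof (cases n)
  case 0
  then show ?thesis
    using assms(2) pp_length_0 by simp
next
  case (Suc n')
  have *: "pp_length (Suc j) - pp_length j = 1" if "Suc j \<le> n" for j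
    using that
  proof (induction j)
    case 0
    have "pp_length 1 = 2"
      using pp_length_Suc[of 0 2] stage_base pp_length_0 by simp
    then show ?case
      using pp_length_0 by simp
  next
    case (Suc j)
    then show ?case
      using pp_length_step[of j] assms(1)[of j] assms(1)[of "Suc j"] assms(1)[of "Suc (Suc j)"]
      by auto
  qed
  have eq: "pp_length n = Suc (pp_length n')"
    using *[of n'] Suc by simp
  show ?thesis
    using assms(2)
  proof (induction i)
    case (Suc i)
    then have "i < pp_length n'"
      using eq by simp
    from stageD(5)[OF stage_pp_length this]
    have "u (Suc i) = u i"
      using *[of n'] assms(1)[of n'] assms(1)[of n] \<open>n = Suc n'\<close> by auto
    then show ?case
      using Suc by simp
  qed simp
qed

lemma last_antipalindrome:
  assumes "{False, True} \<subseteq> set (u [0 \<rightarrow> pp_length n])" "\<not> anti n"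
  obtains m where "m < n" "anti m" "\<And>j. m < j \<Longrightarrow> j \<le> n \<Longrightarrow> \<not> anti j"
proof -
  have "\<exists>m\<le>n. anti m"
  proof (rule ccontr)
    assume none: "\<not> (\<exists>m\<le>n. anti m)"
    have "x = u 0" if x: "x \<in> set (u [0 \<rightarrow> pp_length n])" for x
    proof -
      obtain i where "i < pp_length n" "x = u i"
        using x unfolding set_subsequence by blast
      then show ?thesis
        using constant_if_no_antipalindrome[of n i] none by blast
    qed
    then show False
      using assms(1) by (metis (full_types) insert_subset)
  qed
  then obtain m0 where m0: "m0 \<le> n \<and> anti m0"
    by blast
  define m where "m = (GREATEST m. m \<le> n \<and> anti m)"
  have m: "m \<le> n \<and> anti m"
    unfolding m_def by (rule GreatestI_nat[where P = "\<lambda>m. m \<le> n \<and> anti m" and b = n, OF m0]) simp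
  have "j \<le> m" if "j \<le> n \<and> anti j" for j
    unfolding m_def using that by (rule Greatest_le_nat[where b = n]) simp
  then have "\<not> anti j" if "m < j" "j \<le> n" for j
    using that leD by blast
  moreover have "m < n"
    using m assms(2) le_neq_implies_less by blast
  ultimately show thesis
    using that[of m] m by blast
qed

text \<open>After the first palindrome of the run, keeping the increment would complement again and
  give an antipalindrome, so the increment becomes \<open>pp_length m + 1\<close>, whose shift does
  not complement. Later it cannot be replaced, since the replacing shift would complement. So
  \<open>pp_length m + 1\<close> is a true period throughout the run and the attractor
  extends.\<close>

lemma attracts_after_antipalindrome:
  assumes "m < n" "anti m" "\<And>j. m < j \<Longrightarrow> j \<le> n \<Longrightarrow> \<not> anti j"
  shows "attracts u (pp_length n) {2 * pp_length m - pp_length (Suc m), pp_length m}"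
proof -
  let ?\<Gamma> = "{2 * pp_length m - pp_length (Suc m), pp_length m}"
  have base: "attracts u (pp_length (Suc m)) ?\<Gamma>"
    using assms by (intro stage_attracts[OF stage_pp_length]) force
  have diff: "pp_length (Suc j) - pp_length j = pp_length m + 1" if "Suc m \<le> j" "j < n" for j
    using that
  proof (induction j rule: dec_induct)
    case base
    then show ?case
      using pp_length_step[of m] assms(2) assms(3)[of "Suc m"] assms(3)[of "Suc (Suc m)"]
      by auto
  next
    case (step j)
    then show ?case
      using pp_length_step[of j] assms(3)[of j] assms(3)[of "Suc j"] assms(3)[of "Suc (Suc j)"]
      by auto
  qed
  show ?thesis
  proof (cases "n = Suc m")
    case False
    then obtain j where j: "n = Suc j" "Suc m \<le> j"
      using assms(1) by (cases n) auto
    have eq: "pp_length n - pp_length j = pp_length m + 1" "pp_length j < pp_length n"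
      using diff[of j] j pp_length_less[of j] by auto
    show ?thesis
    proof (rule attracts_period_extend[OF base, where p = "pp_length m + 1"])
      show "pp_length (Suc m) \<le> pp_length n"
        using assms(1) enumerate_mono_le_iff[OF infinite_pseudopal_lengths] by simp
      show "pp_length m + 1 \<le> pp_length (Suc m)"
        using pp_length_less[of m] by simp
      show "u (i + (pp_length m + 1)) = u i" if "i + (pp_length m + 1) < pp_length n" for i
      proof -
        have "i < pp_length j"
          using that eq by linarith
        from stageD(5)[OF stage_pp_length this] show ?thesis
          using eq j assms(3)[of j] assms(3)[of "Suc j"] by auto
      qed
    qed auto
  qed (use base in simp)
qed

lemma attractor_pair_if_attracts:
  assumes "attracts u (pp_length n) {2 * pp_length m - pp_length (Suc m), pp_length m}" "m < n"
  shows "attractor {2 * pp_length m - pp_length (Suc m), pp_length m} (u [0 \<rightarrow> pp_length n])"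
proof (rule attractor_subsequence[OF assms(1)])
  have "pp_length m < pp_length n"
    using assms(2) enumerate_mono_iff[OF infinite_pseudopal_lengths] by simp
  then show "{2 * pp_length m - pp_length (Suc m), pp_length m} \<subseteq> {0..<pp_length n}"
    using pp_length_less[of m] by auto
qed

lemma anti_flip: "anti (Suc n) \<Longrightarrow> u (pp_length n - 1) \<noteq> u (pp_length (Suc n) - 1)"
  using stageD(6)[OF stage_pp_length[of n]] by auto

lemma attractor_pair_exists:
  assumes both: "{False, True} \<subseteq> set (u [0 \<rightarrow> pp_length n])"
  shows "\<exists>x y. attractor {x, y} (u [0 \<rightarrow> pp_length n])"
proof (cases "anti n")
  case True
  then obtain n' where n: "n = Suc n'"
    using pp_length_0 by (cases n) auto
  have "attracts u (pp_length n) {2 * pp_length n' - pp_length (Suc n'), pp_length n'}"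
    unfolding n by (rule stage_attracts[OF stage_pp_length]) (use anti_flip True n in blast)
  then show ?thesis
    using attractor_pair_if_attracts n by blast
next
  case False
  obtain m where "m < n" "anti m" "\<And>j. m < j \<Longrightarrow> j \<le> n \<Longrightarrow> \<not> anti j"
    using last_antipalindrome[OF both False] by blast
  then show ?thesis
    using attracts_after_antipalindrome attractor_pair_if_attracts by blast
qed

text \<open>The lower bound comes from the letters. It is attained by a pair if both letters occur,
  by position 0 for a non-empty constant prefix, and by the empty set for the empty one.\<close>

lemma card_minimal_attractor:
  assumes pp: "pseudopalindrome (u [0 \<rightarrow> k])" and \<Gamma>: "minimal_attractor \<Gamma> (u [0 \<rightarrow> k])"
  shows "card \<Gamma> = card (set (u [0 \<rightarrow> k]))"
proof (rule antisym)
  let ?w = "u [0 \<rightarrow> k]"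
  show "card (set ?w) \<le> card \<Gamma>"
    using \<Gamma> attractor_card_ge unfolding minimal_attractor_def by blast
  have "\<exists>\<Delta>. attractor \<Delta> ?w \<and> card \<Delta> \<le> card (set ?w)"
  proof (cases "{False, True} \<subseteq> set ?w")
    case True
    then have "k \<noteq> 0"
      by auto
    then have "k \<in> pseudopal_lengths u"
      using pp by (simp add: pseudopal_lengths_def)
    then obtain n where n: "k = pp_length n"
      using enumerate_Ex[OF infinite_pseudopal_lengths] by metis
    obtain x y where "attractor {x, y} ?w"
      using attractor_pair_exists[of n] True n by blast
    moreover have "card {False, True} \<le> card (set ?w)"
      using True by (intro card_mono) auto
    moreover have "card {x, y} \<le> 2"
      by (simp add: card_insert_if)
    ultimately show ?thesis
      by (intro exI[of _ "{x, y}"]) simp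
  next
    case False
    have const: "u i = u j" if "i < k" "j < k" for i j
    proof -
      have "u i \<in> set ?w" "u j \<in> set ?w"
        using that unfolding set_subsequence by blast+
      then show ?thesis
        using False by (metis (full_types) bot.extremum insert_subset)
    qed
    show ?thesis
    proof (cases "k = 0")
      case True
      have "attractor {} ?w"
        unfolding True by (rule attractor_subsequence) (auto simp: attracts_def)
      then show ?thesis
        by (intro exI[of _ "{}"]) simp
    next
      case False
      have "attracts u k {0}"
        unfolding attracts_def
      proof (intro allI impI)
        fix i h
        assume "i + h < k"
        moreover from this have "\<forall>r\<le>h. u (0 + r) = u (i + r)"
          by (intro allI impI const) auto
        ultimately show "\<exists>s. s + h < k \<and> (\<forall>r\<le>h. u (s + r) = u (i + r)) \<and>
            (\<exists>g\<in>{0}. s \<le> g \<and> g \<le> s + h)"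
          by (intro exI[of _ 0]) auto
      qed
      then have "attractor {0} ?w"
        by (rule attractor_subsequence) (use False in simp)
      moreover have "1 \<le> card (set ?w)"
        using False by (simp add: Suc_le_eq card_gt_0_iff)
      ultimately show ?thesis
        by (intro exI[of _ "{0}"]) simp
    qed
  qed
  then show "card \<Gamma> \<le> card (set ?w)"
    using \<Gamma> unfolding minimal_attractor_def by (meson order_trans)
qed

lemma palindrome_pp_length: "palindrome (u [0 \<rightarrow> pp_length n]) \<longleftrightarrow> \<not> anti n"
  and antipalindrome_pp_length: "antipalindrome (u [0 \<rightarrow> pp_length n]) \<longleftrightarrow> anti n"
  using palindrome_iff[OF pp_length_mem, of n] by simp_all

lemma longest_palindrome_followed_by:
  assumes "\<not> anti (Suc n)" "anti n"
  shows "longest_followed_by palindrome (\<not> u (pp_length n)) (u [0 \<rightarrow> pp_length (Suc n)])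
    (u [0 \<rightarrow> 2 * pp_length n - pp_length (Suc n)])"
  by (rule stage_longest_followed_by[OF stage_pp_length])
     (use assms palindrome_subsequence_iff[of u] in auto)

lemma longest_antipalindrome_followed_by:
  assumes "anti (Suc n)"
  shows "longest_followed_by antipalindrome (\<not> u (pp_length n)) (u [0 \<rightarrow> pp_length (Suc n)])
    (u [0 \<rightarrow> 2 * pp_length n - pp_length (Suc n)])"
  by (rule stage_longest_followed_by[OF stage_pp_length anti_flip[OF assms]])
     (use assms antipalindrome_subsequence_iff[of u] in auto)

end

theorem theorem19:
  fixes u :: "nat \<Rightarrow> bool"
  assumes "standard_cs_rote u"
  defines "W \<equiv> pseudopal_prefix u"
  shows
    "(\<forall>k \<Gamma>. pseudopalindrome (u [0 \<rightarrow> k]) \<and> minimal_attractor \<Gamma> (u [0 \<rightarrow> k]) \<longrightarrow>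
        card \<Gamma> = card (set (u [0 \<rightarrow> k]))) \<and>
     infinite (pseudopal_lengths u) \<and>
     (\<forall>n a. n \<ge> 1 \<and> {False, True} \<subseteq> set (W n) \<and> prefix (W (n - 1) @ [a]) (W n) \<longrightarrow>
        (antipalindrome (W n) \<longrightarrow>
           (\<exists>w. longest_followed_by antipalindrome (\<not> a) (W n) w \<and>
                minimal_attractor {length w, length (W (n - 1))} (W n))) \<and>
        (palindrome (W n) \<and> antipalindrome (W (n - 1)) \<longrightarrow>
           (\<exists>w. longest_followed_by palindrome (\<not> a) (W n) w \<and>
                minimal_attractor {length w, length (W (n - 1))} (W n))) \<and>
        (palindrome (W n) \<and> palindrome (W (n - 1)) \<longrightarrow>
           (let m = (LEAST m. 1 \<le> m \<and> m \<le> n \<and> (\<forall>i\<in>{m..n}. palindrome (W i)))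
            in m \<ge> 2 \<and> antipalindrome (W (m - 1)) \<and>
               (\<exists>b w. prefix (W (m - 1) @ [b]) (W m) \<and>
                  longest_followed_by palindrome (\<not> b) (W m) w \<and>
                  minimal_attractor {length w, length (W (m - 1))} (W n)))))"
proof (intro conjI allI impI)
  interpret standard_rote u
    by unfold_locales (rule assms)
  show "card \<Gamma> = card (set (u [0 \<rightarrow> k]))"
    if "pseudopalindrome (u [0 \<rightarrow> k]) \<and> minimal_attractor \<Gamma> (u [0 \<rightarrow> k])" for k \<Gamma>
    using that card_minimal_attractor by blast
  show "infinite (pseudopal_lengths u)"
    by (rule infinite_pseudopal_lengths)
  fix n a
  assume asm: "n \<ge> 1 \<and> {False, True} \<subseteq> set (W n) \<and> prefix (W (n - 1) @ [a]) (W n)"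
  have W: "W (Suc j) = u [0 \<rightarrow> pp_length j]" for j
    by (simp add: W_def pseudopal_prefix_def)
  \<comment> \<open>\<open>W 1\<close> is a single letter, so \<open>n \<ge> 2\<close> and
    \<open>W (n - 1)\<close> is not the irrelevant value \<open>W 0\<close>.\<close>
  have "n \<noteq> 1"
    using asm W[of 0] pp_length_0 by auto
  then obtain j where n: "n = Suc (Suc j)"
    using asm by (cases n; cases "n - 1") auto
  have Wn: "W n = u [0 \<rightarrow> pp_length (Suc j)]" "W (n - 1) = u [0 \<rightarrow> pp_length j]"
    using W n by simp_all
  have both: "{False, True} \<subseteq> set (u [0 \<rightarrow> pp_length (Suc j)])"
    using asm Wn by simp
  have a: "a = u (pp_length j)"
  proof -
    have "followed_by (u [0 \<rightarrow> pp_length j]) a (u [0 \<rightarrow> pp_length (Suc j)])"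
      using asm Wn by (simp add: followed_by_def)
    then obtain m where m: "u [0 \<rightarrow> pp_length j] = u [0 \<rightarrow> m]" "u m = a"
      unfolding followed_by_subsequence_iff by blast
    have "m = pp_length j"
      using m(1) by (metis subsequence_length diff_zero)
    then show ?thesis
      using m(2) by simp
  qed
  have minimal: "minimal_attractor {2 * pp_length m - pp_length (Suc m), pp_length m}
      (u [0 \<rightarrow> pp_length (Suc j)])"
    if "attracts u (pp_length (Suc j)) {2 * pp_length m - pp_length (Suc m), pp_length m}"
      "m < Suc j" for m
    by (rule minimal_attractor_pair[OF attractor_pair_if_attracts[OF that] both])
  have minimal_flip: "minimal_attractor {2 * pp_length j - pp_length (Suc j), pp_length j}
      (u [0 \<rightarrow> pp_length (Suc j)])"
    if "u (pp_length j - 1) \<noteq> u (pp_length (Suc j) - 1)"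
    by (rule minimal[OF stage_attracts[OF stage_pp_length that]]) simp
  show "\<exists>w. longest_followed_by antipalindrome (\<not> a) (W n) w \<and>
      minimal_attractor {length w, length (W (n - 1))} (W n)" if "antipalindrome (W n)"
  proof -
    have "anti (Suc j)"
      using that unfolding Wn antipalindrome_pp_length .
    then show ?thesis
      unfolding Wn a using longest_antipalindrome_followed_by[of j] minimal_flip anti_flip[of j]
      by (intro exI[of _ "u [0 \<rightarrow> 2 * pp_length j - pp_length (Suc j)]"]) simp
  qed
  show "\<exists>w. longest_followed_by palindrome (\<not> a) (W n) w \<and>
      minimal_attractor {length w, length (W (n - 1))} (W n)"
    if "palindrome (W n) \<and> antipalindrome (W (n - 1))"
  proof -
    have "\<not> anti (Suc j)" "anti j"
      using that unfolding Wn antipalindrome_pp_length palindrome_pp_length by blast+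
    then show ?thesis
      unfolding Wn a using longest_palindrome_followed_by[of j] minimal_flip
      by (intro exI[of _ "u [0 \<rightarrow> 2 * pp_length j - pp_length (Suc j)]"]) simp
  qed
  show "let m = (LEAST m. 1 \<le> m \<and> m \<le> n \<and> (\<forall>i\<in>{m..n}. palindrome (W i)))
      in m \<ge> 2 \<and> antipalindrome (W (m - 1)) \<and>
        (\<exists>b w. prefix (W (m - 1) @ [b]) (W m) \<and> longest_followed_by palindrome (\<not> b) (W m) w \<and>
          minimal_attractor {length w, length (W (m - 1))} (W n))"
    if "palindrome (W n) \<and> palindrome (W (n - 1))"
  proof -
    have "\<not> anti (Suc j)"
      using that unfolding Wn palindrome_pp_length by blast
    then obtain m where m: "m < Suc j" "anti m" "\<And>i. m < i \<Longrightarrow> i \<le> Suc j \<Longrightarrow> \<not> anti i"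
      using last_antipalindrome[OF both] by blast
    have Wm: "W (Suc (Suc m)) = u [0 \<rightarrow> pp_length (Suc m)]"
      "W (Suc (Suc m) - 1) = u [0 \<rightarrow> pp_length m]"
      using W by simp_all
    \<comment> \<open>The index \<open>m\<close> of the last antipalindrome counts from 0, so the
      run of palindromes starts at number \<open>Suc (Suc m)\<close>; a smaller start would include
      the antipalindrome \<open>W (Suc m)\<close>.\<close>
    have least: "(LEAST m. 1 \<le> m \<and> m \<le> n \<and> (\<forall>i\<in>{m..n}. palindrome (W i))) = Suc (Suc m)"
    proof (rule Least_equality)
      have "palindrome (W i)" if i: "i \<in> {Suc (Suc m)..n}" for i
      proof -
        obtain i' where i': "i = Suc i'"
          using i by (cases i) auto
        show ?thesis
          unfolding i' W palindrome_pp_length using m(3)[of i'] i i' n by simp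
      qed
      then show "1 \<le> Suc (Suc m) \<and> Suc (Suc m) \<le> n \<and>
          (\<forall>i\<in>{Suc (Suc m)..n}. palindrome (W i))"
        using m(1) n by simp
      show "Suc (Suc m) \<le> y" if "1 \<le> y \<and> y \<le> n \<and> (\<forall>i\<in>{y..n}. palindrome (W i))" for y
      proof (rule ccontr)
        assume "\<not> Suc (Suc m) \<le> y"
        then have "palindrome (W (Suc m))"
          using that m(1) n by auto
        then show False
          using m(2) unfolding W palindrome_pp_length by blast
      qed
    qed
    have pre: "prefix (u [0 \<rightarrow> pp_length m] @ [u (pp_length m)]) (u [0 \<rightarrow> pp_length (Suc m)])"
      using followed_by_subsequence_iff[of "u [0 \<rightarrow> pp_length m]" "u (pp_length m)" u]
        pp_length_less[of m] unfolding followed_by_def by blast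
    have longest: "longest_followed_by palindrome (\<not> u (pp_length m)) (u [0 \<rightarrow> pp_length (Suc m)])
        (u [0 \<rightarrow> 2 * pp_length m - pp_length (Suc m)])"
      using m by (intro longest_palindrome_followed_by) simp_all
    have attr: "minimal_attractor {2 * pp_length m - pp_length (Suc m), pp_length m} (W n)"
      unfolding Wn(1) by (rule minimal[OF attracts_after_antipalindrome[OF m] m(1)])
    have antipal: "antipalindrome (u [0 \<rightarrow> pp_length m])"
      using m(2) unfolding antipalindrome_pp_length .
    show ?thesis
      unfolding Let_def least Wm
    proof (intro conjI exI)
      show "minimal_attractor {length (u [0 \<rightarrow> 2 * pp_length m - pp_length (Suc m)]),
          length (u [0 \<rightarrow> pp_length m])} (W n)"
        using attr by simp
    qed (rule pre longest antipal | simp)+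
  qed
qed

end
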